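(* Suppose Assumptions A1, A2, A3 (stated in the context) hold. Let $b_1>b_2>\cdots>b_n>0$ be $n$ numbers with $b_1>1$ and $$P(x)=x^{n+1}-b_1x^n+\sum_{i=1}^{n-1}(b_i-b_{i+1})x^{n-i}+b_n>0\quad\text{for all }x\in(1,b_1),$$ and suppose there are constants $L_1,L_2>0$ such that $|f_j(x)|\le L_1+L_2|x|^{b_j}$ for all $x\in\mathbb{R}$ and $1\le j\le n$. Then the least-squares estimator is strongly consistent in the closed-loop system described in the context; more precisely, $$\|\hat\theta_{t+1}-\theta\|^2=O\left(\frac{\log t}{t}\right)\quad\text{almost surely (as }t\to\infty).$$
   Context: Setting: $n\ge2$; $\theta=(\theta_1,\ldots,\theta_n)^\tau\in\mathbb{R}^n$ is an unknown (random) parameter vector; $\phi=(f_1,\ldots,f_n)^\tau:\mathbb{R}\to\mathbb{R}^n$ is a known measurable vector function, and $E\subset\mathbb{R}$ is an open set such that $f_j\in C^n(E)$ for $1\le j\le n$. $\|\cdot\|$ is the Euclidean norm. The system is $$y_{t+1}=\theta^\tau\phi(y_t)+u_t+w_{t+1}=\sum_{j=1}^n\theta_jf_j(y_t)+u_t+w_{t+1},\quad t\ge0,$$ with initial condition $y_0\in\mathbb{R}$ arbitrary. Assumptions. A1: $\{w_t\}$ is an i.i.d. random sequence with $w_1\sim N(0,\sigma^2)$, $\sigma>0$. A2: $\theta\sim N(\theta_0,I_n)$ is independent of $\{w_t\}$. A3: $f_1,\ldots,f_n$ are linearly independent on $E$. Closed-loop system: with $\phi_t:=\phi(y_t)$,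 the least-squares (LS) estimate $\hat\theta_t$ and the matrices $P_t$ are defined by $\hat\theta_0=\theta_0$, $P_0=I_n$, $$\hat\theta_{t+1}=\hat\theta_t+\sigma^{-2}P_{t+1}\phi_t(y_{t+1}-u_t-\phi_t^\tau\hat\theta_t),\qquad P_{t+1}=P_t-(\sigma^2+\phi_t^\tau P_t\phi_t)^{-1}P_t\phi_t\phi_t^\tau P_t,$$ and the control is $u_t=-\hat\theta_t^\tau\phi_t$, $t\ge0$. A bound $O(\cdot)$ almost surely means with an almost surely finite, possibly random, constant. *)

theory Defs
  imports "HOL-Probability.Probability"
begin

text \<open>The function \<open>g\<close> is of class \<open>C\<^sup>k\<close> on \<open>E\<close>. Only used for open \<open>E\<close>: the derivatives at
  points of \<open>E\<close> are two-sided, so for other sets the values of \<open>g\<close> outside \<open>E\<close> would matter.\<close>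

definition Ck_on :: "nat \<Rightarrow> (real \<Rightarrow> real) \<Rightarrow> real set \<Rightarrow> bool" where
  "Ck_on k g E \<longleftrightarrow>
     (\<forall>i<k. \<forall>x\<in>E. (deriv ^^ i) g field_differentiable at x) \<and>
     continuous_on E ((deriv ^^ k) g)"

definition components_lin_indep_on :: "(real \<Rightarrow> real ^ 'n) \<Rightarrow> real set \<Rightarrow> bool" where
  "components_lin_indep_on f E \<longleftrightarrow>
     (\<forall>c :: real ^ 'n. (\<forall>x\<in>E. (\<Sum>j\<in>UNIV. c $ j * f x $ j) = 0) \<longrightarrow> c = 0)"

definition mv_normal_density :: "real ^ 'n \<Rightarrow> real ^ 'n ^ 'n \<Rightarrow> real ^ 'n \<Rightarrow> real" where
  "mv_normal_density \<mu> S x =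
     exp (- ((x - \<mu>) \<bullet> (matrix_inv S *v (x - \<mu>))) / 2) / sqrt ((2 * pi) ^ CARD('n) * det S)"

text \<open>The constant \<open>indep_var\<close> of the library requires both random variables to take values in
  the same type; here one takes values in \<open>real ^ 'n\<close> and the other is a whole sequence.
  Independence of the generated sigma algebras is stated instead.\<close>

definition indep_rvs ::
  "'a measure \<Rightarrow> 'b measure \<Rightarrow> ('a \<Rightarrow> 'b) \<Rightarrow> 'c measure \<Rightarrow> ('a \<Rightarrow> 'c) \<Rightarrow> bool" where
  "indep_rvs M N X K Y \<longleftrightarrow>
     X \<in> measurable M N \<and> Y \<in> measurable M K \<and>
     prob_space.indep_set M
       (sets (vimage_algebra (space M) X N)) (sets (vimage_algebra (space M) Y K))"

text \<open>The product \<open>x y\<^sup>\<tau>\<close> of a column and a row vector.\<close>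

definition outer_prod :: "real ^ 'n \<Rightarrow> real ^ 'n \<Rightarrow> real ^ 'n ^ 'n" where
  "outer_prod x y = (\<chi> i j. x $ i * y $ j)"

text \<open>The closed-loop system along a single sample path: \<open>\<theta>\<close> is the realized parameter, \<open>w\<close> the
  realized noise, \<open>h\<close> the sequence of least-squares estimates, \<open>u\<close> the control.\<close>

definition ls_closed_loop ::
  "real \<Rightarrow> real ^ 'n \<Rightarrow> (real \<Rightarrow> real ^ 'n) \<Rightarrow> real \<Rightarrow> real ^ 'n \<Rightarrow> (nat \<Rightarrow> real) \<Rightarrow>
   (nat \<Rightarrow> real) \<Rightarrow> (nat \<Rightarrow> real) \<Rightarrow> (nat \<Rightarrow> real ^ 'n) \<Rightarrow> (nat \<Rightarrow> real ^ 'n ^ 'n) \<Rightarrow> bool" where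
  "ls_closed_loop \<sigma> \<theta>0 f y0 \<theta> w y u h P \<longleftrightarrow>
     y 0 = y0 \<and> h 0 = \<theta>0 \<and> P 0 = mat 1 \<and>
     (\<forall>t. y (t + 1) = \<theta> \<bullet> f (y t) + u t + w (t + 1)) \<and>
     (\<forall>t. u t = - (h t \<bullet> f (y t))) \<and>
     (\<forall>t. P (t + 1) =
        P t - inverse (\<sigma>\<^sup>2 + f (y t) \<bullet> (P t *v f (y t))) *\<^sub>R
                (P t ** outer_prod (f (y t)) (f (y t)) ** P t)) \<and>
     (\<forall>t. h (t + 1) =
        h t + (inverse (\<sigma>\<^sup>2) * (y (t + 1) - u t - f (y t) \<bullet> h t)) *\<^sub>R (P (t + 1) *v f (y t)))"

end

theory Submission
  imports Defs "HOL-Real_Asymp.Real_Asymp"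
begin

text \<open>Let \<open>m\<^sub>t = (\<theta> - h\<^sub>t) \<bullet> f(y\<^sub>t)\<close>, so that \<open>y\<^sub>t\<^sub>+\<^sub>1 = m\<^sub>t + w\<^sub>t\<^sub>+\<^sub>1\<close>, let \<open>Q\<^sub>t\<close> be the inverse of \<open>P\<^sub>t\<close>, and let \<open>V\<^sub>t\<close> be
  the energy of the error \<open>\<theta> - h\<^sub>t\<close> with respect to \<open>Q\<^sub>t\<close>. With \<open>s\<^sub>t\<^sup>2 = \<sigma>\<^sup>2 + f(y\<^sub>t) \<bullet> P\<^sub>t f(y\<^sub>t)\<close>, the energy
  plus the sum of \<open>y\<^sub>i\<^sub>+\<^sub>1\<^sup>2 / s\<^sub>i\<^sup>2\<close> equals \<open>\<parallel>\<theta> - \<theta>0\<parallel>\<^sup>2\<close> plus the sum of \<open>w\<^sub>i\<^sub>+\<^sub>1\<^sup>2 / \<sigma>\<^sup>2\<close>. Since the latter sum is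
  \<open>O(t)\<close>, \<open>\<bar>y\<^sub>i\<^sub>+\<^sub>1\<bar>\<close> exceeds \<open>s\<^sub>i\<close> at most by a power of \<open>t\<close>, and \<open>m\<^sub>i\<^sup>2 / s\<^sub>i\<^sup>2\<close> is bounded on average.

  The increments \<open>a\<^sub>i = ln (s\<^sub>i / \<sigma>)\<close> sum up to \<open>ln (det Q\<^sub>t) / 2\<close>. Expanding the determinant, the growth
  condition on \<open>f\<close> bounds this sum by \<open>\<Sum> b\<^sub>j a\<^sub>\<tau>\<^sub>(\<^sub>j\<^sub>)\<close> for distinct earlier indices \<open>\<tau>(j)\<close>, up to
  \<open>O(log t)\<close>. Hence if the partial sums grow at most by a factor \<open>x\<close> per step, they grow at most by
  \<open>F(x) = \<Sum> (b\<^sub>k - b\<^sub>k\<^sub>+\<^sub>1) (1 - x\<^sup>-\<^sup>k)\<close>. As \<open>P(x) = x\<^sup>n (x - F(x))\<close>, the polynomial criterion says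
  \<open>F(x) < x\<close> for \<open>x \<ge> 1\<close>, so iterating \<open>F\<close> ends below 1 and \<open>det Q\<^sub>t\<close> is polynomially bounded.

  Consequently \<open>m\<^sub>i\<close> is bounded along a set of times of positive density, at each of which \<open>y\<^sub>i\<^sub>+\<^sub>1\<close> hits
  any given interval with probability bounded below; finitely many intervals in \<open>E\<close> excite all
  directions, so the least eigenvalue of \<open>Q\<^sub>t\<close> is at least \<open>c t\<close>. On the other hand
  \<open>V\<^sub>t \<le> \<parallel>\<theta> - \<theta>0\<parallel>\<^sup>2 + ln (det Q\<^sub>t) + O(log t) = O(log t)\<close>, because \<open>exp (V\<^sub>t / 2) / sqrt (det Q\<^sub>t)\<close> is, up to
  the factor \<open>exp (\<parallel>\<theta> - \<theta>0\<parallel>\<^sup>2 / 2)\<close>, a product of likelihood ratios.\<close>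

section \<open>Partial sums dominated by weighted increments\<close>

text \<open>If the partial sums grew exactly by the factor \<open>x\<close>, the last
  \<open>k\<close> increments would carry the share \<open>1 - (1 / x) ^ k\<close> of the total, and
  this is the extreme case for \<open>k\<close> distinct indices. In the induction, removing the
  newest index \<open>t\<close> from \<open>I\<close> costs one factor \<open>1 / x\<close>.\<close>

lemma sum_subset_le_geometric:
  fixes a e :: "nat \<Rightarrow> real" and x H :: real
  assumes x: "x \<ge> 1" and H: "H \<ge> 0" and e: "mono e" and e0: "\<And>t. e t \<ge> 0"
    and a: "\<And>t. a t \<ge> 0" and step: "\<And>t. a t \<le> (x - 1) * (\<Sum>i<t. a i) + H * e t"
  shows "I \<subseteq> {..<t} \<Longrightarrow>
    (\<Sum>i\<in>I. a i) \<le> (1 - (1 / x) ^ card I) * (\<Sum>i<t. a i) + card I * H * e t"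
proof (induction t arbitrary: I)
  case 0
  then show ?case by simp
next
  case (Suc t)
  define S where "S = (\<Sum>i<t. a i)"
  have e_le: "e t \<le> e (Suc t)" using e by (simp add: mono_def)
  have pow: "(1 / x) ^ k \<le> 1" for k using x by (simp add: power_le_one)
  show ?case
  proof (cases "t \<in> I")
    case False
    then have sub: "I \<subseteq> {..<t}" using Suc.prems by (auto simp: less_Suc_eq)
    have "(\<Sum>i\<in>I. a i) \<le> (1 - (1 / x) ^ card I) * S + card I * H * e t"
      using Suc.IH[OF sub] by (simp add: S_def)
    also have "\<dots> \<le> (1 - (1 / x) ^ card I) * (S + a t) + card I * H * e (Suc t)"
      using a[of t] pow[of "card I"] e_le H by (intro add_mono mult_left_mono) auto
    finally show ?thesis by (simp add: S_def)
  next
    case True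
    define I' where "I' = I - {t}"
    define k where "k = card I'"
    have fin: "finite I'" using Suc.prems by (auto simp: I'_def intro: finite_subset)
    have I: "I = insert t I'" "t \<notin> I'" using True by (auto simp: I'_def)
    have card: "card I = Suc k" using I fin by (simp add: k_def)
    have sub: "I' \<subseteq> {..<t}" using Suc.prems by (auto simp: I'_def less_Suc_eq)
    define z where "z = (1 / x) ^ k"
    have z0: "z > 0" using x by (simp add: z_def)
    have "z / x = (1 / x) ^ Suc k" by (simp add: z_def)
    then have z1: "z / x \<le> 1" using pow[of "Suc k"] by metis
    \<comment> \<open>The share \<open>z / x\<close> of the newest increment is charged to the older
      sum; the rest of \<open>a t\<close> already occurs in the claim.\<close>
    have "z / x * a t \<le> z / x * ((x - 1) * S + H * e t)"
      using step[of t] z0 x unfolding S_def by (intro mult_left_mono) auto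
    also have "\<dots> = (z - z / x) * S + (z / x) * (H * e t)" using x by (simp add: field_simps)
    also have "\<dots> \<le> (z - z / x) * S + 1 * (H * e t)"
      using z1 H e0[of t] by (intro add_left_mono mult_right_mono) auto
    finally have 1: "z / x * a t \<le> (z - z / x) * S + H * e t" by simp
    have "(\<Sum>i\<in>I. a i) = a t + (\<Sum>i\<in>I'. a i)" using I fin by simp
    also have "\<dots> \<le> a t + ((1 - z) * S + k * H * e t)"
      using Suc.IH[OF sub] by (simp add: S_def z_def k_def)
    also have "\<dots> \<le> (1 - z / x) * (S + a t) + (Suc k) * H * e t"
      using 1 by (simp add: algebra_simps)
    also have "\<dots> \<le> (1 - z / x) * (S + a t) + (Suc k) * H * e (Suc t)"
      using e_le H z1 by (intro add_mono mult_left_mono) auto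
    finally show ?thesis unfolding card by (simp add: S_def z_def)
  qed
qed

text \<open>Abel summation: \<open>b\<close> is the tail sum of \<open>d\<close>, so the weighted
  sum splits into layers \<open>j \<le> k\<close>. Layer \<open>k\<close> involves at most
  \<open>k\<close> distinct indices, to which the geometric bound applies.\<close>

lemma weighted_sum_le:
  fixes a e d b :: "nat \<Rightarrow> real" and x H :: real
  assumes x: "x \<ge> 1" and H: "H \<ge> 0" and e: "mono e" and e0: "\<And>t. e t \<ge> 0"
    and a: "\<And>t. a t \<ge> 0" and step: "\<And>t. a t \<le> (x - 1) * (\<Sum>i<t. a i) + H * e t"
    and d: "\<And>k. k \<in> {1..n} \<Longrightarrow> d k \<ge> 0"
    and b: "\<And>j. j \<in> {1..n} \<Longrightarrow> b j = (\<Sum>k=j..n. d k)"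
    and J: "J \<subseteq> {1..n}" "inj_on \<tau> J" "\<tau> ` J \<subseteq> {..<t}"
  shows "(\<Sum>j\<in>J. b j * a (\<tau> j)) \<le>
    (\<Sum>k=1..n. d k * (1 - (1 / x) ^ k)) * (\<Sum>i<t. a i) + (\<Sum>k=1..n. d k * k) * H * e t"
proof -
  define S where "S = (\<Sum>i<t. a i)"
  have S0: "S \<ge> 0" unfolding S_def by (intro sum_nonneg a)
  have finJ: "finite J" using J(1) finite_subset by blast
  have "(\<Sum>j\<in>J. b j * a (\<tau> j)) = (\<Sum>j\<in>J. \<Sum>k=1..n. if j \<le> k then d k * a (\<tau> j) else 0)"
  proof (rule sum.cong[OF refl])
    fix j assume "j \<in> J"
    then have j: "j \<in> {1..n}" using J(1) by auto
    have "{k \<in> {1..n}. j \<le> k} = {j..n}" using j by auto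
    then show "b j * a (\<tau> j) = (\<Sum>k=1..n. if j \<le> k then d k * a (\<tau> j) else 0)"
      by (subst sum.inter_filter[symmetric]) (simp_all add: b[OF j] sum_distrib_right)
  qed
  also have "\<dots> = (\<Sum>k=1..n. \<Sum>j\<in>J. if j \<le> k then d k * a (\<tau> j) else 0)"
    by (rule sum.swap)
  also have "\<dots> \<le> (\<Sum>k=1..n. d k * ((1 - (1 / x) ^ k) * S + k * H * e t))"
  proof (rule sum_mono)
    fix k assume k: "k \<in> {1..n}"
    define I where "I = \<tau> ` ({j \<in> J. j \<le> k})"
    have inj: "inj_on \<tau> ({j \<in> J. j \<le> k})" using J(2) by (rule inj_on_subset) auto
    have "card I = card ({j \<in> J. j \<le> k})" unfolding I_def by (rule card_image[OF inj])
    also have "\<dots> \<le> card {1..k}" using J(1) by (intro card_mono) auto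
    finally have cI: "card I \<le> k" by simp
    have "(\<Sum>j\<in>J. if j \<le> k then d k * a (\<tau> j) else 0) = d k * (\<Sum>i\<in>I. a i)"
      using finJ by (subst sum.inter_filter[symmetric]) (simp_all add: I_def sum.reindex[OF inj] sum_distrib_left)
    also have "\<dots> \<le> d k * ((1 - (1 / x) ^ card I) * S + card I * H * e t)"
      using sum_subset_le_geometric[OF x H e e0 a step, of I t] J(3) d[OF k] unfolding S_def
      by (intro mult_left_mono) (auto simp: I_def)
    also have "\<dots> \<le> d k * ((1 - (1 / x) ^ k) * S + k * H * e t)"
    proof -
      have "(1 / x) ^ k \<le> (1 / x) ^ card I"
        using x cI by (intro power_decreasing) auto
      then show ?thesis using d[OF k] S0 cI H e0[of t]
        by (intro mult_left_mono add_mono mult_right_mono) auto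
    qed
    finally show "(\<Sum>j\<in>J. if j \<le> k then d k * a (\<tau> j) else 0) \<le> d k * ((1 - (1 / x) ^ k) * S + k * H * e t)" .
  qed
  also have "\<dots> = (\<Sum>k=1..n. d k * (1 - (1 / x) ^ k)) * S + (\<Sum>k=1..n. d k * k) * H * e t"
    by (simp add: sum_distrib_right sum.distrib distrib_left mult.assoc)
  finally show ?thesis by (simp add: S_def)
qed

text \<open>By \<open>bound\<close>, a growth factor \<open>x\<close> of the partial sums improves
  to \<open>F x\<close>. The iteration starts at \<open>b 1\<close> and descends below 1, where the
  recursion closes.\<close>

lemma partial_sums_le_of_contraction:
  fixes a e d b :: "nat \<Rightarrow> real" and n :: nat
  defines "F \<equiv> \<lambda>x::real. \<Sum>k=1..n. d k * (1 - (1 / x) ^ k)"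
  assumes e: "mono e" and e0: "\<And>t. e t \<ge> 0" and a: "\<And>t. a t \<ge> 0"
    and d: "\<And>k. k \<in> {1..n} \<Longrightarrow> d k \<ge> 0"
    and b: "\<And>j. j \<in> {1..n} \<Longrightarrow> b j = (\<Sum>k=j..n. d k)"
    and b1: "b 1 \<ge> 1" and n: "n \<ge> 1"
    and F: "\<And>x. x \<ge> 1 \<Longrightarrow> F x < x"
    and bound: "\<And>t v. (\<And>J \<tau>. J \<subseteq> {1..n} \<Longrightarrow> inj_on \<tau> J \<Longrightarrow> \<tau> ` J \<subseteq> {..<t} \<Longrightarrow>
      (\<Sum>j\<in>J. b j * a (\<tau> j)) \<le> v) \<Longrightarrow> (\<Sum>i<Suc t. a i) \<le> v + e t"
  shows "\<exists>C. \<forall>t. (\<Sum>i<t. a i) \<le> C * e t"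
proof -
  define S where "S t = (\<Sum>i<t. a i)" for t
  have S0: "S t \<ge> 0" for t unfolding S_def by (intro sum_nonneg a)
  have S_Suc: "S (Suc t) = S t + a t" for t by (simp add: S_def)
  define ok where "ok x \<longleftrightarrow> (\<exists>H\<ge>0. \<forall>t. S (Suc t) \<le> x * S t + H * e t)" for x
  have ok_b1: "ok (b 1)"
    unfolding ok_def
  proof (intro exI[of _ 1] conjI allI)
    fix t
    have "(\<Sum>i<Suc t. a i) \<le> b 1 * S t + e t"
    proof (rule bound)
      fix J and \<tau> :: "nat \<Rightarrow> nat" assume J: "J \<subseteq> {1..n}" "inj_on \<tau> J" "\<tau> ` J \<subseteq> {..<t}"
      have "(\<Sum>j\<in>J. b j * a (\<tau> j)) \<le> (\<Sum>j\<in>J. b 1 * a (\<tau> j))"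
      proof (intro sum_mono mult_right_mono a)
        fix j assume "j \<in> J"
        then have j: "j \<in> {1..n}" using J(1) by auto
        show "b j \<le> b 1" unfolding b[OF j] using n j d by (subst b) (auto intro!: sum_mono2)
      qed
      also have "\<dots> = b 1 * (\<Sum>i\<in>\<tau> ` J. a i)" by (simp add: sum.reindex[OF J(2)] sum_distrib_left)
      also have "\<dots> \<le> b 1 * S t"
        unfolding S_def using b1 J(3) a by (intro mult_left_mono sum_mono2) auto
      finally show "(\<Sum>j\<in>J. b j * a (\<tau> j)) \<le> b 1 * S t" .
    qed
    then show "S (Suc t) \<le> b 1 * S t + 1 * e t" by (simp add: S_def)
  qed simp
  have ok_F: "ok (F x)" if x: "x \<ge> 1" and "ok x" for x
  proof -
    obtain H where H: "H \<ge> 0" "\<And>t. S (Suc t) \<le> x * S t + H * e t"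
      using \<open>ok x\<close> unfolding ok_def by auto
    have step: "a t \<le> (x - 1) * (\<Sum>i<t. a i) + H * e t" for t
      using H(2)[of t] unfolding S_Suc by (simp add: S_def algebra_simps)
    show ?thesis
      unfolding ok_def
    proof (intro exI[of _ "(\<Sum>k=1..n. d k * k) * H + 1"] conjI allI)
      show "0 \<le> (\<Sum>k=1..n. d k * k) * H + 1"
        using H(1) d by (intro add_nonneg_nonneg mult_nonneg_nonneg sum_nonneg) auto
      fix t
      have "(\<Sum>i<Suc t. a i) \<le> (F x * S t + (\<Sum>k=1..n. d k * k) * H * e t) + e t"
        using weighted_sum_le[OF x H(1) e e0 a step d b] unfolding S_def F_def by (intro bound) auto
      then show "S (Suc t) \<le> F x * S t + ((\<Sum>k=1..n. d k * k) * H + 1) * e t"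
        by (simp add: S_def algebra_simps)
    qed
  qed
  \<comment> \<open>By compactness \<open>x - F x\<close> has a positive minimum on
    \<open>{1..b 1}\<close>, so each application of \<open>F\<close> lowers the factor by at least
    \<open>\<delta>\<close>.\<close>
  have "continuous_on {1..b 1} (\<lambda>x. x - F x)"
    unfolding F_def by (intro continuous_intros) auto
  then obtain x0 where x0: "x0 \<in> {1..b 1}" "\<And>x. x \<in> {1..b 1} \<Longrightarrow> x0 - F x0 \<le> x - F x"
    using continuous_attains_inf[of "{1..b 1}" "\<lambda>x. x - F x"] b1 by auto
  define \<delta> where "\<delta> = x0 - F x0"
  have \<delta>: "\<delta> > 0" using F x0(1) by (auto simp: \<delta>_def)
  have F_le: "F x \<le> x - \<delta>" if "x \<in> {1..b 1}" for x
    using x0(2)[OF that] by (simp add: \<delta>_def)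
  have "\<exists>x\<le>b 1. ok x \<and> (x < 1 \<or> x \<le> b 1 - real k * \<delta>)" for k
  proof (induction k)
    case 0
    then show ?case using ok_b1 by auto
  next
    case (Suc k)
    then obtain x where x: "x \<le> b 1" "ok x" "x < 1 \<or> x \<le> b 1 - real k * \<delta>" by blast
    show ?case
    proof (cases "x < 1")
      case False
      then have x1: "x \<ge> 1" by simp
      have "F x \<le> b 1 - real (Suc k) * \<delta>" "F x \<le> b 1"
        using F_le[of x] x x1 \<delta> by (auto simp: algebra_simps)
      with ok_F[OF x1 x(2)] show ?thesis by blast
    qed (use x in blast)
  qed
  moreover obtain k :: nat where "b 1 < real k * \<delta>"
    using reals_Archimedean3[OF \<delta>] by auto
  ultimately obtain x where x: "x < 1" "ok x"
    by (smt (verit, best))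
  obtain H where H: "H \<ge> 0" "\<And>t. S (Suc t) \<le> x * S t + H * e t"
    using x(2) unfolding ok_def by auto
  \<comment> \<open>Since \<open>S t \<le> S (Suc t)\<close> and \<open>x < 1\<close>, the term
    \<open>x * S t\<close> is absorbed on the left.\<close>
  have "S t \<le> H / (1 - x) * e t" for t
  proof -
    have "(1 - x) * S t \<le> H * e t" using H(2)[of t] a[of t] unfolding S_Suc by (simp add: algebra_simps)
    then show ?thesis using x(1) by (simp add: field_simps)
  qed
  then show ?thesis unfolding S_def by blast
qed

text \<open>Multiplying the difference of the two sides by \<open>x ^ n\<close> gives the polynomial
  of \<open>P\<close>, which settles \<open>1 < x < b 1\<close>. At \<open>x = 1\<close> the left
  side vanishes, and for \<open>x \<ge> b 1\<close> it stays below \<open>b 1\<close>.\<close>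

lemma contraction_of_polynomial_pos:
  fixes b d :: "nat \<Rightarrow> real" and n :: nat
  assumes n: "n \<ge> 1" and d: "\<And>k. k \<in> {1..<n} \<Longrightarrow> d k = b k - b (k + 1)" "d n = b n"
    and d_pos: "\<And>k. k \<in> {1..n} \<Longrightarrow> d k > 0"
    and b: "b 1 = (\<Sum>k=1..n. d k)"
    and P: "\<And>x. 1 < x \<Longrightarrow> x < b 1 \<Longrightarrow>
      x ^ (n + 1) - b 1 * x ^ n + (\<Sum>i = 1..n - 1. (b i - b (i + 1)) * x ^ (n - i)) + b n > 0"
    and x: "x \<ge> 1"
  shows "(\<Sum>k=1..n. d k * (1 - (1 / x) ^ k)) < x"
proof -
  have F: "(\<Sum>k=1..n. d k * (1 - (1 / x) ^ k)) = b 1 - (\<Sum>k=1..n. d k * (1 / x) ^ k)"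
    unfolding b by (simp add: right_diff_distrib sum_subtractf)
  have pos: "(\<Sum>k=1..n. d k * (1 / x) ^ k) > 0"
    using n x d_pos by (intro sum_pos) auto
  consider "x = 1" | "1 < x" "x < b 1" | "x \<ge> b 1" using x by linarith
  then show ?thesis
  proof cases
    case 2
    have "x ^ n * (\<Sum>k=1..n. d k * (1 / x) ^ k) = (\<Sum>k=1..n. d k * x ^ (n - k))"
      unfolding sum_distrib_left
    proof (rule sum.cong[OF refl])
      fix k assume "k \<in> {1..n}"
      then have "x ^ n = x ^ k * x ^ (n - k)" by (simp flip: power_add)
      then show "x ^ n * (d k * (1 / x) ^ k) = d k * x ^ (n - k)"
        using x by (simp add: power_one_over)
    qed
    also have "\<dots> = (\<Sum>k = 1..n - 1. d k * x ^ (n - k)) + d n"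
      using n by (cases n) auto
    also have "(\<Sum>k = 1..n - 1. d k * x ^ (n - k)) = (\<Sum>i = 1..n - 1. (b i - b (i + 1)) * x ^ (n - i))"
      by (intro sum.cong) (auto simp: d(1))
    finally have "0 < x ^ n * (x - b 1 + (\<Sum>k=1..n. d k * (1 / x) ^ k))"
      using P[OF 2] d(2) by (simp add: algebra_simps)
    then show ?thesis unfolding F using x by (simp add: zero_less_mult_iff)
  qed (use F pos x in auto)
qed

section \<open>Determinants of rank-one updates\<close>

text \<open>Multilinearity in all rows at once: in the Leibniz formula the product of sums expands
  over the functions \<open>g\<close> that choose one summand per row.\<close>

lemma det_sum_rows:
  fixes a :: "'n::finite \<Rightarrow> 'k \<Rightarrow> ('a::comm_ring_1) ^ 'n"
  assumes S: "finite S"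
  shows "det (\<chi> i. \<Sum>s\<in>S. a i s) = (\<Sum>g\<in>PiE UNIV (\<lambda>_. S). det (\<chi> i. a i (g i)))"
proof -
  have "det (\<chi> i. \<Sum>s\<in>S. a i s) =
    (\<Sum>p | p permutes UNIV. of_int (sign p) * (\<Prod>i\<in>UNIV. \<Sum>s\<in>S. a i s $ p i))"
    unfolding det_def by (simp add: sum_component)
  also have "\<dots> = (\<Sum>p | p permutes UNIV. \<Sum>g\<in>PiE UNIV (\<lambda>_. S). of_int (sign p) * (\<Prod>i\<in>UNIV. a i (g i) $ p i))"
    using S by (simp add: prod_sum_PiE sum_distrib_left)
  also have "\<dots> = (\<Sum>g\<in>PiE UNIV (\<lambda>_. S). \<Sum>p | p permutes UNIV. of_int (sign p) * (\<Prod>i\<in>UNIV. a i (g i) $ p i))"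
    by (rule sum.swap)
  finally show ?thesis unfolding det_def by simp
qed

lemma abs_det_le_Leibniz:
  fixes A :: "real ^ 'n ^ 'n"
  assumes "\<And>p. p permutes UNIV \<Longrightarrow> (\<Prod>i\<in>UNIV. \<bar>A $ i $ p i\<bar>) \<le> B"
  shows "\<bar>det A\<bar> \<le> fact CARD('n) * B"
proof -
  have "\<bar>det A\<bar> \<le> (\<Sum>p | p permutes (UNIV :: 'n set). \<bar>of_int (sign p) * (\<Prod>i\<in>UNIV. A $ i $ p i)\<bar>)"
    unfolding det_def by (rule sum_abs)
  also have "\<dots> \<le> (\<Sum>p | p permutes (UNIV :: 'n set). B)"
    using assms by (intro sum_mono) (auto simp: abs_mult abs_prod sign_def)
  finally show ?thesis by (simp add: card_permutations)
qed

text \<open>Cramer's rule for the identity matrix.\<close>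

lemma det_row_replace_identity:
  fixes v :: "real ^ 'n"
  shows "det (\<chi> i. if i = k then v else axis i 1) = v $ k"
proof -
  have "(\<Sum>i\<in>UNIV. v $ i *s row i (mat 1)) = v"
    by (simp add: vec_eq_iff sum_component row_def mat_def if_distrib cong: if_cong)
  moreover have "row i (mat 1 :: real ^ 'n ^ 'n) = axis i 1" for i
    by (auto simp: vec_eq_iff row_def mat_def axis_def)
  ultimately show ?thesis
    using cramer_lemma_transpose[of k v "mat 1"] by (simp cong: if_cong)
qed

text \<open>Row \<open>k\<close> is \<open>v\<close> itself, so the multiples of \<open>v\<close> in
  the other rows come from row operations, which preserve the determinant.\<close>

lemma det_rank_one_rows_aux:
  fixes u v :: "real ^ 'n"
  assumes "finite T" "k \<notin> T"
  shows "det (\<chi> i. if i = k then v else if i \<in> T then axis i 1 + u $ i *s v else axis i 1) = v $ k"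
  using assms
proof (induction T)
  case empty
  then show ?case by (simp add: det_row_replace_identity cong: if_cong)
next
  case (insert j T)
  define A where "A = (\<chi> i. if i = k then v else if i \<in> T then axis i 1 + u $ i *s v else axis i 1)"
  have "(\<chi> i. if i = k then v else if i \<in> insert j T then axis i 1 + u $ i *s v else axis i 1)
    = (\<chi> i. if i = j then row j A + u $ j *s row k A else row i A)"
    using insert by (auto simp: vec_eq_iff row_def A_def)
  moreover have "det (\<chi> i. if i = j then row j A + u $ j *s row k A else row i A) = det A"
    using insert by (intro det_row_operation) auto
  moreover have "det A = v $ k" unfolding A_def using insert by blast
  ultimately show ?case by metis
qed

text \<open>Row \<open>k\<close> splits into its unit vector and a multiple of \<open>v\<close>; the
  first part gives the induction hypothesis, the second the value \<open>v $ k\<close>.\<close>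

lemma det_rank_one_rows:
  fixes u v :: "real ^ 'n"
  assumes "finite T"
  shows "det (\<chi> i. if i \<in> T then axis i 1 + u $ i *s v else axis i 1) = 1 + (\<Sum>i\<in>T. u $ i * v $ i)"
  using assms
proof (induction T)
  case empty
  have "(\<chi> i. axis i 1) = (mat 1 :: real ^ 'n ^ 'n)" by (auto simp: vec_eq_iff mat_def axis_def)
  then show ?case by simp
next
  case (insert k T)
  define c where "c i = (if i \<in> T then axis i 1 + u $ i *s v else axis i 1)" for i
  have eq: "(\<chi> i. if i \<in> insert k T then axis i 1 + u $ i *s v else axis i 1) =
    (\<chi> i. if i = k then axis k 1 + u $ k *s v else c i)"
    by (auto simp: vec_eq_iff c_def)
  have eq': "(\<chi> i. if i = k then axis k 1 else c i) = (\<chi> i. c i)"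
    using insert by (auto simp: vec_eq_iff c_def)
  have "det (\<chi> i. if i = k then v else c i) = v $ k"
    unfolding c_def by (rule det_rank_one_rows_aux[OF insert(1,2)])
  moreover have "det (\<chi> i. c i) = 1 + (\<Sum>i\<in>T. u $ i * v $ i)"
    unfolding c_def by (rule insert.IH)
  ultimately show ?case
    unfolding eq det_row_add det_row_mul eq' using insert by simp
qed

lemma det_mat_1_plus_outer_prod: "det (mat 1 + outer_prod u v) = 1 + u \<bullet> v"
proof -
  have "mat 1 + outer_prod u v = (\<chi> i. if i \<in> UNIV then axis i 1 + u $ i *s v else axis i 1)"
    by (auto simp: vec_eq_iff mat_def outer_prod_def axis_def)
  also have "det \<dots> = 1 + u \<bullet> v" by (subst det_rank_one_rows) (auto simp: inner_vec_def)
  finally show ?thesis .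
qed

lemma outer_prod_mult_vec: "outer_prod u v *v x = (v \<bullet> x) *\<^sub>R u"
  by (simp add: vec_eq_iff outer_prod_def matrix_vector_mult_def inner_vec_def sum_distrib_left
      mult_ac)

lemma matrix_mult_outer_prod: "A ** outer_prod u v = outer_prod (A *v u) v"
  by (simp add: vec_eq_iff outer_prod_def matrix_vector_mult_def matrix_matrix_mult_def
      sum_distrib_left mult_ac)

lemma outer_prod_scaleR: "outer_prod (c *\<^sub>R u) v = c *\<^sub>R outer_prod u v"
  by (simp add: vec_eq_iff outer_prod_def)

text \<open>The matrix determinant lemma: factor \<open>Q\<close> out on the left, which leaves the
  identity plus an outer product with first vector \<open>c *\<^sub>R (P *v x)\<close>.\<close>

lemma det_plus_outer_prod:
  fixes Q P :: "real ^ 'n ^ 'n"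
  assumes "Q ** P = mat 1"
  shows "det (Q + c *\<^sub>R outer_prod x x) = det Q * (1 + c * (x \<bullet> (P *v x)))"
proof -
  have "Q *v (P *v x) = x" by (simp only: matrix_vector_mul_assoc assms matrix_vector_mul_lid)
  then have "Q ** outer_prod (c *\<^sub>R (P *v x)) x = c *\<^sub>R outer_prod x x"
    unfolding matrix_mult_outer_prod by (simp only: matrix_vector_mult_scaleR outer_prod_scaleR)
  then have "Q ** (mat 1 + outer_prod (c *\<^sub>R (P *v x)) x) = Q + c *\<^sub>R outer_prod x x"
    by (simp only: matrix_add_ldistrib matrix_mul_rid)
  then have "det (Q + c *\<^sub>R outer_prod x x) = det (Q ** (mat 1 + outer_prod (c *\<^sub>R (P *v x)) x))"
    by simp
  also have "\<dots> = det Q * (1 + c * (x \<bullet> (P *v x)))"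
    by (simp add: det_mul det_mat_1_plus_outer_prod inner_commute)
  finally show ?thesis .
qed

text \<open>The \<open>n\<close> rows of the matrix are sums over the identity part (index \<open>t\<close>) and the summands
  \<open>i < t\<close>; by multilinearity the determinant is a sum over choices of one summand per row, and
  a choice that uses the same \<open>i < t\<close> twice has proportional rows, so it contributes nothing.\<close>

lemma abs_det_info_le:
  fixes v :: "nat \<Rightarrow> real ^ 'n"
  assumes c: "c \<ge> 0" and B: "\<And>J \<tau> p. inj_on \<tau> J \<Longrightarrow> \<tau> ` J \<subseteq> {..<t} \<Longrightarrow> p permutes UNIV \<Longrightarrow>
     (\<Prod>j\<in>J. c * \<bar>v (\<tau> j) $ j\<bar> * \<bar>v (\<tau> j) $ p j\<bar>) \<le> B"
  shows "\<bar>det (mat 1 + c *\<^sub>R (\<Sum>i<t. outer_prod (v i) (v i)))\<bar> \<le> fact CARD('n) * B * (real t + 1) ^ CARD('n)"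
proof -
  define a where "a j s = (if s = t then axis j 1 else (c * v s $ j) *s v s)" for j s
  \<comment> \<open>The empty \<open>J\<close> has product 1.\<close>
  have B0: "B \<ge> 0" using B[of undefined "{}" id] by (simp add: permutes_id)
  have "mat 1 + c *\<^sub>R (\<Sum>i<t. outer_prod (v i) (v i)) = (\<chi> j. \<Sum>s\<le>t. a j s)"
  proof -
    have "(\<Sum>s\<le>t. a j s) = (\<Sum>s<t. (c * v s $ j) *s v s) + axis j 1" for j
      unfolding lessThan_Suc_atMost[symmetric] by (simp add: a_def)
    then show ?thesis
      by (auto simp: vec_eq_iff mat_def outer_prod_def axis_def sum_component sum_distrib_left mult_ac)
  qed
  then have "\<bar>det (mat 1 + c *\<^sub>R (\<Sum>i<t. outer_prod (v i) (v i)))\<bar> = \<bar>\<Sum>g\<in>PiE UNIV (\<lambda>_. {..t}). det (\<chi> j. a j (g j))\<bar>"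
    by (simp add: det_sum_rows)
  also have "\<dots> \<le> (\<Sum>g\<in>PiE (UNIV :: 'n set) (\<lambda>_. {..t}). fact CARD('n) * B)"
  proof (rule order_trans[OF sum_abs], rule sum_mono)
    fix g :: "'n \<Rightarrow> nat" assume "g \<in> PiE UNIV (\<lambda>_. {..t})"
    then have g: "g j \<le> t" for j by (auto simp: PiE_def)
    \<comment> \<open>The rows that choose a rank-one summand instead of the identity part.\<close>
    define J where "J = {j. g j \<noteq> t}"
    show "\<bar>det (\<chi> j. a j (g j))\<bar> \<le> fact CARD('n) * B"
    proof (cases "inj_on g J")
      case True
      show ?thesis
      proof (rule abs_det_le_Leibniz)
        fix p :: "'n \<Rightarrow> 'n" assume p: "p permutes UNIV"
        have "(\<Prod>j\<in>UNIV. \<bar>(\<chi> j. a j (g j)) $ j $ p j\<bar>) \<le>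
          (\<Prod>j\<in>UNIV. if j \<in> J then c * \<bar>v (g j) $ j\<bar> * \<bar>v (g j) $ p j\<bar> else 1)"
          using c by (intro prod_mono) (auto simp: a_def J_def axis_def abs_mult)
        also have "\<dots> = (\<Prod>j\<in>J. c * \<bar>v (g j) $ j\<bar> * \<bar>v (g j) $ p j\<bar>)"
          by (simp add: prod.If_cases)
        also have "\<dots> \<le> B"
          using g by (intro B True p) (auto simp: J_def order.strict_iff_order)
        finally show "(\<Prod>j\<in>UNIV. \<bar>(\<chi> j. a j (g j)) $ j $ p j\<bar>) \<le> B" .
      qed
    next
      case False
      then obtain j k where jk: "j \<noteq> k" "g j = g k" "g k \<noteq> t" by (auto simp: inj_on_def J_def)
      \<comment> \<open>Once their scalar coefficients are pulled out, rows \<open>j\<close> and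
        \<open>k\<close> are equal.\<close>
      have "det (\<chi> j. a j (g j)) = det (\<chi> i. (if i \<in> {j, k} then c * v (g k) $ i else 1) *s
        (if i \<in> {j, k} then v (g k) else a i (g i)))"
        using jk by (intro arg_cong[of _ _ det]) (auto simp: vec_eq_iff a_def)
      also have "\<dots> = 0"
        unfolding det_rows_mul
        using det_identical_rows[of j k "\<chi> i. if i \<in> {j, k} then v (g k) else a i (g i)"] jk(1)
        by (auto simp: row_def vec_eq_iff)
      finally show ?thesis using B0 by simp
    qed
  qed
  also have "\<dots> = fact CARD('n) * B * (real t + 1) ^ CARD('n)"
    by (simp add: card_PiE mult_ac add_ac)
  finally show ?thesis .
qed

section \<open>The closed loop along a sample path\<close>

locale ls_loop =
  fixes \<sigma> :: real and \<theta>0 :: "real ^ 'n" and f :: "real \<Rightarrow> real ^ 'n" and y0 :: real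
    and \<theta> :: "real ^ 'n" and w y u :: "nat \<Rightarrow> real" and h :: "nat \<Rightarrow> real ^ 'n"
    and P :: "nat \<Rightarrow> real ^ 'n ^ 'n"
  assumes sigma_pos: "\<sigma> > 0"
    and loop: "ls_closed_loop \<sigma> \<theta>0 f y0 \<theta> w y u h P"
begin

text \<open>\<open>mean\<close>, \<open>var\<close>, \<open>info\<close>, \<open>energy\<close> and
  \<open>growth\<close> are the quantities m, s^2, Q, V and a of the overview. \<open>info\<close>
  is given by its explicit sum; that it inverts \<open>P\<close> is proved below.\<close>

definition mean :: "nat \<Rightarrow> real" where
  "mean t = (\<theta> - h t) \<bullet> f (y t)"

definition var :: "nat \<Rightarrow> real" where
  "var t = \<sigma>\<^sup>2 + f (y t) \<bullet> (P t *v f (y t))"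

definition info :: "nat \<Rightarrow> real ^ 'n ^ 'n" where
  "info t = mat 1 + (1 / \<sigma>\<^sup>2) *\<^sub>R (\<Sum>i<t. outer_prod (f (y i)) (f (y i)))"

definition energy :: "nat \<Rightarrow> real" where
  "energy t = (\<theta> - h t) \<bullet> (info t *v (\<theta> - h t))"

definition growth :: "nat \<Rightarrow> real" where
  "growth t = ln (var t / \<sigma>\<^sup>2) / 2"

lemma y_0: "y 0 = y0" and h_0: "h 0 = \<theta>0" and P_0: "P 0 = mat 1"
  and y_Suc: "y (Suc t) = mean t + w (Suc t)"
  and u_eq: "u t = - (h t \<bullet> f (y t))"
  and P_Suc: "P (Suc t) = P t - inverse (var t) *\<^sub>R
     (P t ** outer_prod (f (y t)) (f (y t)) ** P t)"
  and h_Suc: "h (Suc t) = h t + (inverse (\<sigma>\<^sup>2) * (y (Suc t) - u t - f (y t) \<bullet> h t)) *\<^sub>R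
     (P (Suc t) *v f (y t))"
  using loop unfolding ls_closed_loop_def mean_def var_def
  by (auto simp: inner_diff_left)

lemma info_mult: "info t *v x = x + (1 / \<sigma>\<^sup>2) *\<^sub>R (\<Sum>i<t. (f (y i) \<bullet> x) *\<^sub>R f (y i))"
proof -
  have "(\<Sum>i\<in>I. outer_prod (f (y i)) (f (y i))) *v x = (\<Sum>i\<in>I. (f (y i) \<bullet> x) *\<^sub>R f (y i))" if "finite I" for I
    using that by (induction I) (auto simp: matrix_vector_mult_add_rdistrib outer_prod_mult_vec)
  then show ?thesis
    by (simp add: info_def matrix_vector_mult_add_rdistrib scaleR_matrix_vector_assoc[symmetric])
qed

lemma info_Suc: "info (Suc t) = info t + (1 / \<sigma>\<^sup>2) *\<^sub>R outer_prod (f (y t)) (f (y t))"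
  by (simp add: info_def scaleR_add_right)

lemma inner_info: "x \<bullet> (info t *v z) = x \<bullet> z + (\<Sum>i<t. (f (y i) \<bullet> x) * (f (y i) \<bullet> z)) / \<sigma>\<^sup>2"
  by (simp add: info_mult inner_add_right inner_sum_right mult_ac inner_commute)

text \<open>Sherman-Morrison. The two claims need each other: inverting the update divides by
  \<open>var t\<close>, and the next lower bound on \<open>var\<close> comes from rewriting the
  quadratic form of \<open>P\<close> as one of \<open>info\<close>.\<close>

lemma info_P_and_var_pos: "info t ** P t = mat 1 \<and> var t \<ge> \<sigma>\<^sup>2"
proof (induction t)
  case 0
  show ?case by (simp add: info_def P_0 var_def)
next
  case (Suc t)
  define \<phi> where "\<phi> = f (y t)"
  have var: "var t > 0" using Suc sigma_pos by (smt (verit) zero_less_power)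
  have P_mult: "P (Suc t) *v x = P t *v x - ((\<phi> \<bullet> (P t *v x)) / var t) *\<^sub>R (P t *v \<phi>)" for x
    by (simp add: P_Suc \<phi>_def matrix_vector_mult_diff_rdistrib scaleR_matrix_vector_assoc[symmetric]
        matrix_vector_mul_assoc[symmetric] outer_prod_mult_vec matrix_vector_mult_scaleR divide_inverse_commute)
  have info_Suc_mult: "info (Suc t) *v z = info t *v z + ((\<phi> \<bullet> z) / \<sigma>\<^sup>2) *\<^sub>R \<phi>" for z
    by (simp add: info_Suc \<phi>_def matrix_vector_mult_add_rdistrib scaleR_matrix_vector_assoc[symmetric]
        outer_prod_mult_vec)
  have inv: "info t *v (P t *v x) = x" for x
    using Suc by (simp add: matrix_vector_mul_assoc)
  have 1: "(info (Suc t) ** P (Suc t)) *v x = x" for x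
  proof -
    have r: "\<phi> \<bullet> (P t *v \<phi>) = var t - \<sigma>\<^sup>2" by (simp add: var_def \<phi>_def)
    have c: "- (c / var t) + (c - c / var t * (\<phi> \<bullet> (P t *v \<phi>))) / \<sigma>\<^sup>2 = 0" for c
      unfolding r using var sigma_pos by (simp add: field_simps)
    have "(info (Suc t) ** P (Suc t)) *v x = x +
      (- ((\<phi> \<bullet> (P t *v x)) / var t) + (\<phi> \<bullet> (P t *v x) - (\<phi> \<bullet> (P t *v x)) / var t * (\<phi> \<bullet> (P t *v \<phi>))) / \<sigma>\<^sup>2) *\<^sub>R \<phi>"
      by (simp add: matrix_vector_mul_assoc[symmetric] P_mult info_Suc_mult inv
          matrix_vector_mult_diff_distrib matrix_vector_mult_scaleR inner_diff_right scaleR_add_left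
          scaleR_diff_left scaleR_add_right diff_divide_distrib)
    also have "\<dots> = x" unfolding c by simp
    finally show ?thesis .
  qed
  then have 2: "info (Suc t) ** P (Suc t) = mat 1"
    by (simp add: matrix_eq)
  define z where "z = P (Suc t) *v f (y (Suc t))"
  have "info (Suc t) *v z = f (y (Suc t))" using 2 by (simp add: z_def matrix_vector_mul_assoc)
  then have "f (y (Suc t)) \<bullet> (P (Suc t) *v f (y (Suc t))) = z \<bullet> (info (Suc t) *v z)"
    by (simp add: z_def inner_commute)
  also have "\<dots> \<ge> 0" unfolding inner_info by (intro add_nonneg_nonneg divide_nonneg_nonneg sum_nonneg) auto
  finally show ?case using 2 by (simp add: var_def)
qed

lemma info_P: "info t ** P t = mat 1" and var_ge: "var t \<ge> \<sigma>\<^sup>2"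
  using info_P_and_var_pos by auto

lemma var_pos: "var t > 0"
  using var_ge[of t] sigma_pos by (smt (verit) zero_less_power)

lemma growth_nonneg: "growth t \<ge> 0"
  using var_ge[of t] sigma_pos by (simp add: growth_def)

lemma var_eq: "var t = \<sigma>\<^sup>2 * exp (2 * growth t)"
  using var_pos[of t] sigma_pos by (simp add: growth_def)

text \<open>Each update multiplies the determinant by \<open>var t / \<sigma>\<^sup>2\<close>, by
  the matrix determinant lemma, so its logarithm telescopes.\<close>

lemma det_info: "det (info t) = exp (2 * (\<Sum>i<t. growth i))"
proof (induction t)
  case (Suc t)
  have "det (info (Suc t)) = det (info t) * (1 + 1 / \<sigma>\<^sup>2 * (f (y t) \<bullet> (P t *v f (y t))))"
    unfolding info_Suc by (rule det_plus_outer_prod[OF info_P])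
  also have "1 + 1 / \<sigma>\<^sup>2 * (f (y t) \<bullet> (P t *v f (y t))) = exp (2 * growth t)"
    using sigma_pos var_eq[of t] unfolding var_def by (simp add: field_simps)
  finally show ?case using Suc by (simp add: exp_add[symmetric] algebra_simps)
qed (simp add: info_def)

lemma energy_eq: "energy t = (norm (\<theta> - h t))\<^sup>2 + (\<Sum>i<t. (f (y i) \<bullet> (\<theta> - h t))\<^sup>2) / \<sigma>\<^sup>2"
  unfolding power2_norm_eq_inner by (simp add: energy_def inner_info power2_eq_square)

lemma energy_nonneg: "energy t \<ge> 0"
  unfolding energy_eq by (intro add_nonneg_nonneg divide_nonneg_nonneg sum_nonneg) auto

text \<open>The sum of the normalized innovations and the value of the regularized least-squares
  criterion at the true parameter, diminished by the energy, are both the minimum of that criterion.\<close>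

lemma energy_identity: "energy t + (\<Sum>i<t. (y (Suc i))\<^sup>2 / var i) =
    (norm (\<theta> - \<theta>0))\<^sup>2 + (\<Sum>i<t. (w (Suc i))\<^sup>2) / \<sigma>\<^sup>2"
proof (induction t)
  case 0
  show ?case by (simp add: energy_eq h_0)
next
  case (Suc t)
  define \<phi> where "\<phi> = f (y t)"
  define z where "z = \<theta> - h t"
  define Y where "Y = y (Suc t)"
  define r where "r = \<phi> \<bullet> (P t *v \<phi>)"
  have r: "r = var t - \<sigma>\<^sup>2" by (simp add: r_def var_def \<phi>_def)
  have m: "\<phi> \<bullet> z = Y - w (Suc t)" by (simp add: Y_def y_Suc mean_def z_def \<phi>_def inner_commute)
  \<comment> \<open>The new matrix maps \<open>\<phi>\<close> to a multiple of its old image, so the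
    estimate moves by \<open>Y / var t\<close> times \<open>P t *v \<phi>\<close>.\<close>
  have "P (Suc t) *v \<phi> = P t *v \<phi> - (r / var t) *\<^sub>R (P t *v \<phi>)"
    by (simp add: P_Suc \<phi>_def r_def matrix_vector_mult_diff_rdistrib scaleR_matrix_vector_assoc[symmetric]
        matrix_vector_mul_assoc[symmetric] outer_prod_mult_vec matrix_vector_mult_scaleR divide_inverse_commute)
  also have "\<dots> = (1 - r / var t) *\<^sub>R (P t *v \<phi>)" by (simp add: scaleR_diff_left)
  also have "1 - r / var t = \<sigma>\<^sup>2 / var t" using var_pos[of t] by (simp add: r field_simps)
  finally have P\<phi>: "P (Suc t) *v \<phi> = (\<sigma>\<^sup>2 / var t) *\<^sub>R (P t *v \<phi>)" .
  have "h (Suc t) = h t + (inverse (\<sigma>\<^sup>2) * Y) *\<^sub>R (P (Suc t) *v \<phi>)"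
    by (simp add: h_Suc u_eq Y_def \<phi>_def inner_commute)
  then have z': "\<theta> - h (Suc t) = z - (Y / var t) *\<^sub>R (P t *v \<phi>)"
    unfolding P\<phi> using sigma_pos by (simp add: z_def)
  define z1 where "z1 = \<theta> - h (Suc t)"
  have inv: "info t *v (P t *v \<phi>) = \<phi>" by (simp add: matrix_vector_mul_assoc info_P)
  have sym: "x \<bullet> (info t *v x') = x' \<bullet> (info t *v x)" for x x' by (simp add: inner_info inner_commute mult.commute)
  \<comment> \<open>The new information matrix is the old one plus a rank-one term, which
    contributes a single square; the old part is expanded in the correction of the estimate.\<close>
  have "energy (Suc t) = z1 \<bullet> (info t *v z1) + (\<phi> \<bullet> z1)\<^sup>2 / \<sigma>\<^sup>2"
    by (simp add: energy_def inner_info z1_def \<phi>_def power2_eq_square add_divide_distrib)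
  also have "z1 \<bullet> (info t *v z1) = energy t - 2 * (Y / var t) * (\<phi> \<bullet> z) + (Y / var t)\<^sup>2 * r"
  proof -
    have "(P t *v \<phi>) \<bullet> (info t *v z) = z \<bullet> \<phi>" using sym[of "P t *v \<phi>" z] inv by simp
    then show ?thesis unfolding z1_def z'
      by (simp add: matrix_vector_mult_diff_distrib matrix_vector_mult_scaleR inv inner_diff_left inner_diff_right
          energy_def z_def[symmetric] r_def inner_commute power2_eq_square algebra_simps)
  qed
  also have "\<phi> \<bullet> z1 = (\<phi> \<bullet> z) - Y / var t * r"
    by (simp add: z1_def z' inner_diff_right r_def)
  finally have "energy (Suc t) = energy t - 2 * (Y / var t) * (Y - w (Suc t)) + (Y / var t)\<^sup>2 * (var t - \<sigma>\<^sup>2)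
      + (Y - w (Suc t) - Y / var t * (var t - \<sigma>\<^sup>2))\<^sup>2 / \<sigma>\<^sup>2"
    unfolding m r .
  also have "\<dots> = energy t + (w (Suc t))\<^sup>2 / \<sigma>\<^sup>2 - Y\<^sup>2 / var t"
    using var_pos[of t] sigma_pos by (simp add: field_simps power2_eq_square)
  finally show ?case using Suc by (simp add: Y_def add_divide_distrib)
qed


section \<open>Polynomial growth of the information determinant\<close>

text \<open>Times shift by one: the logarithm of an output at time \<open>\<tau> j\<close> is
  charged to \<open>growth (\<tau> j - 1)\<close>, or to \<open>\<eta>\<close> alone at time 0. The
  injection \<open>q\<close> relabels rows by exponent indices, so that the hypothesis on earlier
  increments applies.\<close>

lemma weighted_sum_log_obs_le:
  fixes b :: "nat \<Rightarrow> real" and q :: "'n \<Rightarrow> nat"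
  assumes b: "\<And>j. j \<in> {1..n} \<Longrightarrow> b j \<ge> 0"
    and q: "inj q" "range q \<subseteq> {1..n}" and \<tau>: "inj_on \<tau> J" "\<tau> ` J \<subseteq> {..<Suc t}"
    and v: "\<And>J \<tau>. J \<subseteq> {1..n} \<Longrightarrow> inj_on \<tau> J \<Longrightarrow> \<tau> ` J \<subseteq> {..<t} \<Longrightarrow>
      (\<Sum>j\<in>J. b j * growth (\<tau> j)) \<le> v"
    and \<eta>: "\<eta> \<ge> 0" "ln (max 1 \<bar>y 0\<bar>) \<le> \<eta>"
      "\<And>i. i < t \<Longrightarrow> ln (max 1 \<bar>y (Suc i)\<bar>) \<le> growth i + \<eta>"
  shows "(\<Sum>j\<in>J. b (q j) * ln (max 1 \<bar>y (\<tau> j)\<bar>)) \<le> v + (\<Sum>k=1..n. b k) * \<eta>"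
proof -
  define K where "K = {j \<in> J. \<tau> j \<noteq> 0}"
  define \<tau>' where "\<tau>' k = \<tau> (inv q k) - 1" for k
  have qb: "b (q j) \<ge> 0" for j using b[OF subsetD[OF q(2) rangeI]] .
  have "(\<Sum>j\<in>J. b (q j) * ln (max 1 \<bar>y (\<tau> j)\<bar>)) \<le>
    (\<Sum>j\<in>J. (if \<tau> j \<noteq> 0 then b (q j) * growth (\<tau> j - 1) else 0) + b (q j) * \<eta>)"
  proof (rule sum_mono)
    fix j assume j: "j \<in> J"
    have "ln (max 1 \<bar>y (\<tau> j)\<bar>) \<le> (if \<tau> j \<noteq> 0 then growth (\<tau> j - 1) else 0) + \<eta>"
      using \<eta> \<tau>(2) j by (cases "\<tau> j") (auto simp: subset_eq)
    from mult_left_mono[OF this qb[of j]]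
    show "b (q j) * ln (max 1 \<bar>y (\<tau> j)\<bar>) \<le> (if \<tau> j \<noteq> 0 then b (q j) * growth (\<tau> j - 1) else 0) + b (q j) * \<eta>"
      by (auto simp: distrib_left)
  qed
  also have "\<dots> = (\<Sum>j\<in>K. b (q j) * growth (\<tau> j - 1)) + (\<Sum>j\<in>J. b (q j)) * \<eta>"
    unfolding K_def by (subst sum.inter_filter) (simp_all add: sum.distrib sum_distrib_right)
  also have "(\<Sum>j\<in>K. b (q j) * growth (\<tau> j - 1)) = (\<Sum>k\<in>q ` K. b k * growth (\<tau>' k))"
    using q(1) by (subst sum.reindex) (auto simp: \<tau>'_def inj_on_def)
  also have "\<dots> \<le> v"
  proof (rule v)
    show "q ` K \<subseteq> {1..n}" using q(2) by auto
    have "inj_on (\<lambda>j. \<tau> j - 1) K"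
      using \<tau>(1) unfolding K_def inj_on_def by (auto simp: Suc_diff_Suc)
    then show "inj_on \<tau>' (q ` K)" using q(1) by (auto simp: \<tau>'_def inj_on_def)
    show "\<tau>' ` (q ` K) \<subseteq> {..<t}" using \<tau>(2) q(1) by (auto simp: \<tau>'_def K_def subset_eq)
  qed
  also have "(\<Sum>j\<in>J. b (q j)) \<le> (\<Sum>k=1..n. b k)"
  proof -
    have "(\<Sum>j\<in>J. b (q j)) = (\<Sum>k\<in>q ` J. b k)"
      using q(1) by (subst sum.reindex) (auto simp: inj_on_def)
    also have "\<dots> \<le> (\<Sum>k=1..n. b k)" using q(2) b by (intro sum_mono2) auto
    finally show ?thesis .
  qed
  finally show ?thesis using \<eta>(1) by (simp add: mult_right_mono)
qed

text \<open>Expanding \<open>det (info (Suc t))\<close> bounds it by products of components of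
  \<open>f\<close> at distinct times, whose logarithms are weighted sums of logarithms of outputs.
  This supplies the recursive bound that the contraction argument iterates.\<close>

lemma sum_growth_log:
  fixes b :: "nat \<Rightarrow> real"
  assumes idx: "bij_betw idx {1..CARD('n)} (UNIV :: 'n set)"
    and L: "L1 > 0" "L2 > 0"
    and f_growth: "\<And>x j. j \<in> {1..CARD('n)} \<Longrightarrow> \<bar>f x $ idx j\<bar> \<le> L1 + L2 * \<bar>x\<bar> powr b j"
    and b_decreasing: "\<And>i. i \<in> {1..<CARD('n)} \<Longrightarrow> b i > b (i + 1)"
    and b_pos: "b CARD('n) > 0" and b1: "b 1 > 1"
    and poly: "\<And>x. 1 < x \<Longrightarrow> x < b 1 \<Longrightarrow>
      x ^ (CARD('n) + 1) - b 1 * x ^ CARD('n)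
        + (\<Sum>i = 1..CARD('n) - 1. (b i - b (i + 1)) * x ^ (CARD('n) - i)) + b CARD('n) > 0"
    and noise: "\<And>t. (\<Sum>i<t. (w (Suc i))\<^sup>2) \<le> C * (real t + 1)"
  shows "\<exists>C. \<forall>t. (\<Sum>i<t. growth i) \<le> C * ln (real t + 2)"
proof -
  define n where "n = CARD('n)"
  have n: "n \<ge> 1" by (simp add: n_def Suc_leI)
  define d where "d k = (if k < n then b k - b (k + 1) else b k)" for k
  have b_sum: "b j = (\<Sum>k=j..n. d k)" if "j \<in> {1..n}" for j
  proof -
    from that have "j \<le> n" by auto
    then show ?thesis
    proof (induction j rule: inc_induct)
      case (step m)
      then show ?case by (simp add: sum.atLeast_Suc_atMost[of m] d_def)
    qed (simp add: d_def)
  qed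
  have d_pos: "d k > 0" if "k \<in> {1..n}" for k
    using that b_decreasing[of k] b_pos by (auto simp: d_def n_def)
  have b_nonneg: "b j \<ge> 0" if "j \<in> {1..n}" for j
    unfolding b_sum[OF that] using that d_pos by (intro sum_nonneg) (auto intro: less_imp_le)
  define B where "B = (\<Sum>k=1..n. b k)"
  have B: "B \<ge> 0" unfolding B_def using b_nonneg by (intro sum_nonneg) auto
  define q where "q = inv_into {1..n} idx"
  have q: "q j \<in> {1..n}" "idx (q j) = j" for j
    using idx unfolding q_def n_def bij_betw_def by (metis UNIV_I inv_into_into f_inv_into_f)+
  have inj_q: "inj q" using q(2) by (metis injI)
  have C: "C \<ge> 0" using noise[of 0] by simp
  \<comment> \<open>\<open>C3\<close> dominates the initial output squared and, through the energy
    identity, the ratio of each later squared output to \<open>exp (2 * growth i)\<close>, up to a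
    factor \<open>real t + 2\<close>.\<close>
  define C3 where "C3 = 1 + y0\<^sup>2 + \<sigma>\<^sup>2 * ((norm (\<theta> - \<theta>0))\<^sup>2 + C / \<sigma>\<^sup>2)"
  have C3: "C3 \<ge> 1" using C by (simp add: C3_def)
  define \<eta> where "\<eta> t = ln (C3 * (real t + 2)) / 2" for t
  have C3t: "C3 * (real t + 2) \<ge> 1" for t
    using mult_mono[of 1 C3 1 "real t + 2"] C3 by simp
  have \<eta>0: "\<eta> t \<ge> 0" for t using C3t[of t] by (simp add: \<eta>_def)
  have ln_max: "ln (max 1 \<bar>z\<bar>) \<le> g + \<eta> t" if "z\<^sup>2 \<le> C3 * (real t + 2) * exp (2 * g)" "g \<ge> 0" for z g t
  proof -
    have "(max 1 \<bar>z\<bar>)\<^sup>2 \<le> C3 * (real t + 2) * exp (2 * g)"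
      using that C3t[of t] mult_mono[of 1 "C3 * (real t + 2)" 1 "exp (2 * g)"]
      by (auto simp: max_def)
    then have "ln ((max 1 \<bar>z\<bar>)\<^sup>2) \<le> ln (C3 * (real t + 2) * exp (2 * g))"
      using C3 by (subst ln_le_cancel_iff) auto
    also have "\<dots> = 2 * \<eta> t + 2 * g" using C3t[of t] C3
      by (subst ln_mult) (auto simp: \<eta>_def)
    finally show ?thesis by (simp add: ln_realpow)
  qed
  have y0_le: "ln (max 1 \<bar>y 0\<bar>) \<le> \<eta> t" for t
  proof -
    have "y0\<^sup>2 \<le> C3" using C by (simp add: C3_def)
    also have "\<dots> \<le> C3 * (real t + 2)" using mult_left_mono[of 1 "real t + 2" C3] C3 by simp
    finally show ?thesis using ln_max[of "y 0" t 0] by (simp add: y_0)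
  qed
  have y_le: "ln (max 1 \<bar>y (Suc i)\<bar>) \<le> growth i + \<eta> t" if "i < t" for i t
  proof (rule ln_max)
    have "(y (Suc i))\<^sup>2 / var i \<le> (\<Sum>i<t. (y (Suc i))\<^sup>2 / var i)"
      using that less_imp_le[OF var_pos] by (intro member_le_sum) auto
    also have "\<dots> \<le> (norm (\<theta> - \<theta>0))\<^sup>2 + C * (real t + 1) / \<sigma>\<^sup>2"
      using energy_identity[of t] energy_nonneg[of t] noise[of t] sigma_pos
        divide_right_mono[OF noise[of t], of "\<sigma>\<^sup>2"] by simp
    also have "\<dots> \<le> ((norm (\<theta> - \<theta>0))\<^sup>2 + C / \<sigma>\<^sup>2) * (real t + 2)"
      using C sigma_pos by (simp add: field_simps)
    finally have "(y (Suc i))\<^sup>2 \<le> (((norm (\<theta> - \<theta>0))\<^sup>2 + C / \<sigma>\<^sup>2) * (real t + 2)) * var i"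
      using var_pos[of i] by (simp add: field_simps)
    also have "\<dots> = (\<sigma>\<^sup>2 * ((norm (\<theta> - \<theta>0))\<^sup>2 + C / \<sigma>\<^sup>2)) * (real t + 2) * exp (2 * growth i)"
      by (simp add: var_eq)
    also have "\<dots> \<le> C3 * (real t + 2) * exp (2 * growth i)"
      by (intro mult_right_mono) (auto simp: C3_def)
    finally show "(y (Suc i))\<^sup>2 \<le> C3 * (real t + 2) * exp (2 * growth i)" .
  qed (rule growth_nonneg)
  define L where "L = L1 + L2"
  have L_pos: "L > 0" using \<open>L1 > 0\<close> \<open>L2 > 0\<close> by (simp add: L_def)
  have f_le: "\<bar>f x $ j\<bar> \<le> L * exp (b (q j) * ln (max 1 \<bar>x\<bar>))" for x j
  proof -
    have "\<bar>f x $ j\<bar> \<le> L1 + L2 * \<bar>x\<bar> powr b (q j)"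
      using f_growth[of "q j" x] q[of j] by (simp add: n_def)
    also have "\<dots> \<le> L1 * max 1 \<bar>x\<bar> powr b (q j) + L2 * max 1 \<bar>x\<bar> powr b (q j)"
      using b_nonneg[OF q(1)[of j]] \<open>L1 > 0\<close> \<open>L2 > 0\<close>
      by (intro add_mono mult_left_mono powr_mono2) (auto simp: ge_one_powr_ge_zero)
    also have "\<dots> = L * exp (b (q j) * ln (max 1 \<bar>x\<bar>))"
      by (simp add: powr_def L_def distrib_right)
    finally show ?thesis .
  qed
  \<comment> \<open>The maximum with 1 lets \<open>card J\<close> be replaced by \<open>n\<close> in
    the exponent.\<close>
  define K where "K = max 1 (1 / \<sigma>\<^sup>2 * L * L)"
  \<comment> \<open>Half the logarithm of every factor of the determinant bound other than
    \<open>exp (2 * v)\<close>; half, because the determinant is the exponential of twice the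
    sum.\<close>
  define e where "e t = ln (fact n * K ^ n) / 2 + B * \<eta> t + real n / 2 * ln (real t + 2)" for t
  have K: "K \<ge> 1" by (simp add: K_def)
  have factK: "fact n * K ^ n \<ge> (1 :: real)"
    using mult_mono[of 1 "fact n :: real" 1 "K ^ n"] K by (simp add: fact_ge_1)
  have e0: "e t \<ge> 0" for t
    unfolding e_def using factK B \<eta>0[of t] by (intro add_nonneg_nonneg mult_nonneg_nonneg) auto
  have mono_e: "mono e"
  proof (rule monoI)
    fix s t :: nat assume "s \<le> t"
    then have "\<eta> s \<le> \<eta> t" unfolding \<eta>_def using C3 C3t[of s] C3t[of t]
      by (intro divide_right_mono) (subst ln_le_cancel_iff, auto)
    then show "e s \<le> e t" unfolding e_def using B \<open>s \<le> t\<close>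
      by (intro add_mono mult_left_mono) auto
  qed
  have "\<exists>C. \<forall>t. (\<Sum>i<t. growth i) \<le> C * e t"
  proof (rule partial_sums_le_of_contraction[where d = d and b = b and n = n])
    show "(\<Sum>k=1..n. d k * (1 - (1 / x) ^ k)) < x" if "x \<ge> 1" for x
    proof (rule contraction_of_polynomial_pos[where b = b])
      show "b 1 = (\<Sum>k=1..n. d k)" using b_sum[of 1] n by simp
    qed (use n d_pos poly that in \<open>auto simp: d_def n_def\<close>)
  next
    fix t v
    assume v: "\<And>J \<tau>. J \<subseteq> {1..n} \<Longrightarrow> inj_on \<tau> J \<Longrightarrow> \<tau> ` J \<subseteq> {..<t} \<Longrightarrow>
      (\<Sum>j\<in>J. b j * growth (\<tau> j)) \<le> v"
    define D where "D = K ^ n * exp (2 * (v + B * \<eta> t))"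
    have "\<bar>det (info (Suc t))\<bar> \<le> fact n * D * (real (Suc t) + 1) ^ n"
      unfolding info_def n_def
    proof (rule abs_det_info_le)
      fix J :: "'n set" and \<tau> :: "'n \<Rightarrow> nat" and p :: "'n \<Rightarrow> 'n"
      assume \<tau>: "inj_on \<tau> J" "\<tau> ` J \<subseteq> {..<Suc t}" and p: "p permutes UNIV"
      \<comment> \<open>Used with \<open>q\<close> for the row components and with
        \<open>q \<circ> p\<close> for the column components, which is injective because
        \<open>p\<close> is a permutation.\<close>
      have log_le: "(\<Sum>j\<in>J. b (r j) * ln (max 1 \<bar>y (\<tau> j)\<bar>)) \<le> v + B * \<eta> t"
        if "inj r" "range r \<subseteq> {1..n}" for r
        unfolding B_def
        using weighted_sum_log_obs_le[OF b_nonneg that \<tau> v \<eta>0 y0_le y_le] by blast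
      have log_le1: "(\<Sum>j\<in>J. b (q j) * ln (max 1 \<bar>y (\<tau> j)\<bar>)) \<le> v + B * \<eta> t"
        using inj_q q by (intro log_le) auto
      have log_le2: "(\<Sum>j\<in>J. b (q (p j)) * ln (max 1 \<bar>y (\<tau> j)\<bar>)) \<le> v + B * \<eta> t"
        using log_le[of "q \<circ> p"] inj_q q permutes_inj[OF p] by (auto simp: inj_compose image_subset_iff)
      have "(\<Prod>j\<in>J. 1 / \<sigma>\<^sup>2 * \<bar>f (y (\<tau> j)) $ j\<bar> * \<bar>f (y (\<tau> j)) $ p j\<bar>) \<le>
        (\<Prod>j\<in>J. 1 / \<sigma>\<^sup>2 * (L * exp (b (q j) * ln (max 1 \<bar>y (\<tau> j)\<bar>))) * (L * exp (b (q (p j)) * ln (max 1 \<bar>y (\<tau> j)\<bar>))))"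
        using f_le L_pos by (intro prod_mono conjI mult_mono mult_nonneg_nonneg) auto
      also have "\<dots> = (1 / \<sigma>\<^sup>2 * L * L) ^ card J * (exp (\<Sum>j\<in>J. b (q j) * ln (max 1 \<bar>y (\<tau> j)\<bar>)) *
         exp (\<Sum>j\<in>J. b (q (p j)) * ln (max 1 \<bar>y (\<tau> j)\<bar>)))"
        unfolding exp_sum[OF finite] prod.distrib[symmetric] prod_constant[symmetric]
        by (intro prod.cong) auto
      also have "\<dots> \<le> K ^ n * (exp (v + B * \<eta> t) * exp (v + B * \<eta> t))"
      proof (intro mult_mono)
        have "(1 / \<sigma>\<^sup>2 * L * L) ^ card J \<le> K ^ card J"
          using L_pos by (intro power_mono) (auto simp: K_def)
        also have "\<dots> \<le> K ^ n"
          unfolding n_def using K by (intro power_increasing card_mono) auto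
        finally show "(1 / \<sigma>\<^sup>2 * L * L) ^ card J \<le> K ^ n" .
      qed (use log_le1 log_le2 K in auto)
      also have "\<dots> = D" by (simp add: D_def exp_add[symmetric])
      finally show "(\<Prod>j\<in>J. 1 / \<sigma>\<^sup>2 * \<bar>f (y (\<tau> j)) $ j\<bar> * \<bar>f (y (\<tau> j)) $ p j\<bar>) \<le> D" .
    qed simp
    then have "exp (2 * (\<Sum>i<Suc t. growth i)) \<le> fact n * D * (real t + 2) ^ n"
      unfolding det_info by (simp add: add_ac)
    also have "\<dots> = exp (2 * (v + e t))"
    proof -
      have "exp (ln (fact n * K ^ n) + real n * ln (real t + 2)) = fact n * K ^ n * (real t + 2) ^ n"
        using factK K by (simp add: exp_add exp_of_nat_mult)
      moreover have "2 * (v + e t) = (ln (fact n * K ^ n) + real n * ln (real t + 2)) + 2 * (v + B * \<eta> t)"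
        by (simp add: e_def algebra_simps)
      ultimately show ?thesis unfolding D_def by (simp add: exp_add)
    qed
    finally show "(\<Sum>i<Suc t. growth i) \<le> v + e t" by simp
  qed (use mono_e e0 growth_nonneg d_pos b_sum b1 n in \<open>auto intro: less_imp_le\<close>)
  then obtain C' where C': "\<And>t. (\<Sum>i<t. growth i) \<le> C' * e t" by blast
  \<comment> \<open>Constants are absorbed by means of
    \<open>ln (real t + 2) \<ge> ln 2\<close>.\<close>
  define A where "A = (ln (fact n * K ^ n) / 2 + B * ln C3 / 2) / ln 2 + B / 2 + real n / 2"
  have e_le: "e t \<le> A * ln (real t + 2)" for t
  proof -
    have "e t = (ln (fact n * K ^ n) / 2 + B * ln C3 / 2) + (B / 2 + real n / 2) * ln (real t + 2)"
      using C3 ln_mult[of C3 "real t + 2"] by (simp add: e_def \<eta>_def distrib_left distrib_right add_divide_distrib)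
    moreover have "(ln (fact n * K ^ n) / 2 + B * ln C3 / 2) * 1 \<le>
      (ln (fact n * K ^ n) / 2 + B * ln C3 / 2) * (ln (real t + 2) / ln 2)"
      using factK B C3 by (intro mult_left_mono) (auto simp: le_divide_eq)
    ultimately show ?thesis by (simp add: A_def algebra_simps add_divide_distrib)
  qed
  have "(\<Sum>i<t. growth i) \<le> \<bar>C'\<bar> * A * ln (real t + 2)" for t
  proof -
    have "C' * e t \<le> \<bar>C'\<bar> * e t" using e0[of t] by (intro mult_right_mono) auto
    also have "\<dots> \<le> \<bar>C'\<bar> * (A * ln (real t + 2))" using e_le by (intro mult_left_mono) auto
    finally show ?thesis using C'[of t] by simp
  qed
  then show ?thesis by blast
qed


section \<open>Bounded means, excitation and the pathwise rate\<close>

lemma sum_mean_sq_le: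
  assumes noise: "(\<Sum>i<t. (w (Suc i))\<^sup>2) \<le> N"
  shows "(\<Sum>i<t. (mean i)\<^sup>2 / var i) \<le> 2 * (norm (\<theta> - \<theta>0))\<^sup>2 + 4 * N / \<sigma>\<^sup>2"
proof -
  have "(mean i)\<^sup>2 / var i \<le> 2 * ((y (Suc i))\<^sup>2 / var i) + 2 * ((w (Suc i))\<^sup>2 / \<sigma>\<^sup>2)" for i
  proof -
    have "(mean i)\<^sup>2 \<le> 2 * (y (Suc i))\<^sup>2 + 2 * (w (Suc i))\<^sup>2"
      using sum_squares_bound[of "y (Suc i)" "- w (Suc i)"] unfolding y_Suc
      by (simp add: power2_eq_square algebra_simps)
    then have "(mean i)\<^sup>2 / var i \<le> (2 * (y (Suc i))\<^sup>2 + 2 * (w (Suc i))\<^sup>2) / var i"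
      using var_pos[of i] by (intro divide_right_mono) auto
    also have "\<dots> = 2 * ((y (Suc i))\<^sup>2 / var i) + 2 * ((w (Suc i))\<^sup>2 / var i)"
      by (simp add: add_divide_distrib)
    also have "(w (Suc i))\<^sup>2 / var i \<le> (w (Suc i))\<^sup>2 / \<sigma>\<^sup>2"
      using var_ge[of i] sigma_pos by (intro divide_left_mono) (auto simp: var_pos)
    finally show ?thesis by simp
  qed
  then have "(\<Sum>i<t. (mean i)\<^sup>2 / var i) \<le> (\<Sum>i<t. 2 * ((y (Suc i))\<^sup>2 / var i) + 2 * ((w (Suc i))\<^sup>2 / \<sigma>\<^sup>2))"
    by (intro sum_mono) auto
  also have "\<dots> = 2 * (\<Sum>i<t. (y (Suc i))\<^sup>2 / var i) + 2 * ((\<Sum>i<t. (w (Suc i))\<^sup>2) / \<sigma>\<^sup>2)"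
    by (simp add: sum.distrib sum_distrib_left sum_divide_distrib)
  also have "\<dots> \<le> 2 * (norm (\<theta> - \<theta>0))\<^sup>2 + 4 * ((\<Sum>i<t. (w (Suc i))\<^sup>2) / \<sigma>\<^sup>2)"
    using energy_identity[of t] energy_nonneg[of t] by linarith
  also have "(\<Sum>i<t. (w (Suc i))\<^sup>2) / \<sigma>\<^sup>2 \<le> N / \<sigma>\<^sup>2"
    using noise by (intro divide_right_mono) auto
  finally show ?thesis by simp
qed

text \<open>The indicator of \<open>\<bar>mean i\<bar> \<le> K\<close> is bounded below by \<open>1 - (mean i)\<^sup>2 / (var i * N) - growth i\<close>,
  so its average over time does not vanish.\<close>

lemma frequently_bounded_mean:
  assumes noise: "\<And>t. (\<Sum>i<t. (w (Suc i))\<^sup>2) \<le> C * (real t + 1)"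
    and growth: "\<And>t. (\<Sum>i<t. growth i) \<le> C' * ln (real t + 2)"
  shows "\<exists>K::nat. \<forall>\<^sub>F t in sequentially. real t / 2 \<le> card {i. i < t \<and> \<bar>mean i\<bar> \<le> real K}"
proof -
  define A where "A = 2 * (norm (\<theta> - \<theta>0))\<^sup>2 + 4 * C / \<sigma>\<^sup>2"
  have C: "C \<ge> 0" using noise[of 0] by simp
  have A: "A \<ge> 0" using C by (simp add: A_def)
  have sum_le: "(\<Sum>i<t. (mean i)\<^sup>2 / var i) \<le> A * (real t + 1)" for t
  proof -
    have "(\<Sum>i<t. (mean i)\<^sup>2 / var i) \<le> 2 * (norm (\<theta> - \<theta>0))\<^sup>2 + 4 * (C * (real t + 1)) / \<sigma>\<^sup>2"
      by (rule sum_mean_sq_le[OF noise])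
    also have "\<dots> \<le> 2 * (norm (\<theta> - \<theta>0))\<^sup>2 * (real t + 1) + 4 * (C * (real t + 1)) / \<sigma>\<^sup>2"
      by (simp add: mult_left_le algebra_simps)
    also have "\<dots> = A * (real t + 1)" by (simp add: A_def algebra_simps)
    finally show ?thesis .
  qed
  \<comment> \<open>Makes the normalized squared means contribute at most a quarter of the
    time.\<close>
  define N where "N = 4 * (A + 1)"
  have N: "N > 0" using A by (simp add: N_def)
  \<comment> \<open>If \<open>growth i < 1\<close>, then \<open>var i\<close> is below
    \<open>\<sigma>\<^sup>2 * exp 2\<close>, so a mean beyond \<open>K\<close> has square at least
    \<open>N * var i\<close>.\<close>
  obtain K :: nat where K: "sqrt (N * (\<sigma>\<^sup>2 * exp 2)) \<le> real K" using real_arch_simple by blast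
  have ind: "1 - (mean i)\<^sup>2 / var i / N - growth i \<le> (if \<bar>mean i\<bar> \<le> real K then 1 else 0)" for i
  proof (cases "\<bar>mean i\<bar> \<le> real K")
    case True
    moreover have "(mean i)\<^sup>2 / var i / N \<ge> 0" using var_pos[of i] N by simp
    ultimately show ?thesis using growth_nonneg[of i] by simp
  next
    case False
    show ?thesis
    proof (cases "growth i \<ge> 1")
      case True
      moreover have "(mean i)\<^sup>2 / var i / N \<ge> 0" using var_pos[of i] N by simp
      ultimately show ?thesis using False by simp
    next
      case g: False
      have "N * var i \<le> N * (\<sigma>\<^sup>2 * exp 2)"
        unfolding var_eq using g N by (intro mult_left_mono) auto
      also have "\<dots> = (sqrt (N * (\<sigma>\<^sup>2 * exp 2)))\<^sup>2" using N by simp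
      also have "\<dots> \<le> \<bar>mean i\<bar>\<^sup>2" using K False N by (intro power_mono) auto
      finally have "1 \<le> (mean i)\<^sup>2 / var i / N" using N var_pos[of i] by (simp add: field_simps)
      then show ?thesis using growth_nonneg[of i] False by simp
    qed
  qed
  have "real t - (real t + 1) / 4 - C' * ln (real t + 2) \<le> card {i. i < t \<and> \<bar>mean i\<bar> \<le> real K}" for t
  proof -
    have "(\<Sum>i<t. (mean i)\<^sup>2 / var i) / N \<le> A * (real t + 1) / N"
      using sum_le N by (intro divide_right_mono) auto
    also have "\<dots> \<le> (real t + 1) / 4" using A by (simp add: N_def field_simps)
    finally have "real t - (real t + 1) / 4 - C' * ln (real t + 2) \<le>
      real t - (\<Sum>i<t. (mean i)\<^sup>2 / var i) / N - (\<Sum>i<t. growth i)"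
      using growth[of t] by linarith
    also have "\<dots> = (\<Sum>i<t. 1 - (mean i)\<^sup>2 / var i / N - growth i)"
      by (simp add: sum_subtractf sum_divide_distrib)
    also have "\<dots> \<le> (\<Sum>i<t. if \<bar>mean i\<bar> \<le> real K then 1 else 0)" by (intro sum_mono ind)
    also have "\<dots> = card {i \<in> {..<t}. \<bar>mean i\<bar> \<le> real K}"
      by (subst sum.inter_filter[symmetric]) simp_all
    also have "{i \<in> {..<t}. \<bar>mean i\<bar> \<le> real K} = {i. i < t \<and> \<bar>mean i\<bar> \<le> real K}" by auto
    finally show ?thesis .
  qed
  moreover have "\<forall>\<^sub>F t::nat in sequentially. real t / 2 \<le> real t - (real t + 1) / 4 - C' * ln (real t + 2)"
    by real_asymp
  ultimately have "\<forall>\<^sub>F t in sequentially. real t / 2 \<le> card {i. i < t \<and> \<bar>mean i\<bar> \<le> real K}"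
    by (elim eventually_mono) (rule order_trans)
  then show ?thesis by blast
qed

text \<open>Some set in \<open>\<U>\<close> excites the normalized error, and each visit there adds
  at least \<open>\<delta>\<^sup>2\<close> times the squared error to the sum in the energy. Visits
  are counted at \<open>y (Suc i)\<close> with \<open>i < t\<close>, hence the energy at
  \<open>Suc t\<close>.\<close>

lemma norm_error_sq_le_energy:
  fixes c :: real
  assumes \<delta>: "\<delta> > 0" and excite: "\<And>v. norm v = 1 \<Longrightarrow> \<exists>U\<in>\<U>. \<forall>x\<in>U. \<delta> \<le> \<bar>v \<bullet> f x\<bar>"
    and visits: "\<And>U. U \<in> \<U> \<Longrightarrow> c \<le> card {i. i < t \<and> y (Suc i) \<in> U}"
  shows "c * (\<delta>\<^sup>2 / \<sigma>\<^sup>2) * (norm (h (Suc t) - \<theta>))\<^sup>2 \<le> energy (Suc t)"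
proof (cases "\<theta> = h (Suc t)")
  case True
  then show ?thesis using energy_nonneg by simp
next
  case False
  define z where "z = \<theta> - h (Suc t)"
  have z: "norm z > 0" using False by (simp add: z_def)
  have "norm (z /\<^sub>R norm z) = 1" using z by simp
  from excite[OF this] obtain U where U: "U \<in> \<U>" "\<And>x. x \<in> U \<Longrightarrow> \<delta> \<le> \<bar>(z /\<^sub>R norm z) \<bullet> f x\<bar>" by blast
  define I where "I = {i. i < t \<and> y (Suc i) \<in> U}"
  have I: "finite I" "Suc ` I \<subseteq> {..<Suc t}" by (auto simp: I_def)
  have z_le: "\<delta>\<^sup>2 * (norm z)\<^sup>2 \<le> (f x \<bullet> z)\<^sup>2" if "x \<in> U" for x
  proof -
    have "\<delta> * norm z \<le> \<bar>f x \<bullet> z\<bar>"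
      using U(2)[OF that] z by (simp add: abs_mult field_simps inner_commute)
    then have "(\<delta> * norm z)\<^sup>2 \<le> \<bar>f x \<bullet> z\<bar>\<^sup>2" using \<delta> z by (intro power_mono) auto
    then show ?thesis by (simp add: power_mult_distrib)
  qed
  have "c * (\<delta>\<^sup>2 * (norm z)\<^sup>2) \<le> card I * (\<delta>\<^sup>2 * (norm z)\<^sup>2)"
    using visits[OF U(1)] by (intro mult_right_mono) (auto simp: I_def)
  also have "\<dots> = (\<Sum>i\<in>Suc ` I. \<delta>\<^sup>2 * (norm z)\<^sup>2)" by (simp add: card_image)
  also have "\<dots> \<le> (\<Sum>i\<in>Suc ` I. (f (y i) \<bullet> z)\<^sup>2)"
    by (intro sum_mono z_le) (auto simp: I_def)
  also have "\<dots> \<le> (\<Sum>i<Suc t. (f (y i) \<bullet> z)\<^sup>2)"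
    using I by (intro sum_mono2) auto
  finally have "c * (\<delta>\<^sup>2 * (norm z)\<^sup>2) / \<sigma>\<^sup>2 \<le> (\<Sum>i<Suc t. (f (y i) \<bullet> z)\<^sup>2) / \<sigma>\<^sup>2"
    by (intro divide_right_mono) auto
  also have "c * (\<delta>\<^sup>2 * (norm z)\<^sup>2) / \<sigma>\<^sup>2 = c * (\<delta>\<^sup>2 / \<sigma>\<^sup>2) * (norm (h (Suc t) - \<theta>))\<^sup>2"
    by (simp add: z_def norm_minus_commute)
  finally show ?thesis unfolding energy_eq z_def[symmetric]
    by (rule order_trans) simp
qed

text \<open>The energy is at least a multiple of \<open>t\<close> times the squared error, by
  linearly many visits to each exciting set, and at most of order \<open>ln t\<close>; the quotient
  is the rate.\<close>

lemma consistency_pathwise: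
  assumes noise: "\<And>t. (\<Sum>i<t. (w (Suc i))\<^sup>2) \<le> C * (real t + 1)"
    and growth: "\<And>t. (\<Sum>i<t. growth i) \<le> C' * ln (real t + 2)"
    and energy: "\<forall>\<^sub>F t in sequentially.
      energy t \<le> (norm (\<theta> - \<theta>0))\<^sup>2 + 2 * (\<Sum>i<t. growth i) + 4 * ln (real t + 1)"
    and fin: "finite \<U>"
    and visits: "\<And>U K. U \<in> \<U> \<Longrightarrow> \<exists>q>(0::real). \<forall>\<^sub>F t in sequentially.
      q * card {i. i < t \<and> \<bar>mean i\<bar> \<le> real K} - 2 * ln (real t + 1) \<le>
      card {i. i < t \<and> \<bar>mean i\<bar> \<le> real K \<and> y (Suc i) \<in> U}"
    and \<delta>: "\<delta> > 0" and excite: "\<And>v. norm v = 1 \<Longrightarrow> \<exists>U\<in>\<U>. \<forall>x\<in>U. \<delta> \<le> \<bar>v \<bullet> f x\<bar>"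
  shows "(\<lambda>t. (norm (h (t + 1) - \<theta>))\<^sup>2) \<in> O(\<lambda>t. ln (real t) / real t)"
proof -
  obtain K :: nat where K: "\<forall>\<^sub>F t in sequentially. real t / 2 \<le> card {i. i < t \<and> \<bar>mean i\<bar> \<le> real K}"
    using frequently_bounded_mean[OF noise growth] by blast
  define visited where "visited U q \<longleftrightarrow> (\<forall>\<^sub>F t in sequentially.
      q * card {i. i < t \<and> \<bar>mean i\<bar> \<le> real K} - 2 * ln (real t + 1) \<le>
      card {i. i < t \<and> \<bar>mean i\<bar> \<le> real K \<and> y (Suc i) \<in> U})" for U and q :: real
  have "\<exists>q>0. visited U q" if "U \<in> \<U>" for U
    unfolding visited_def by (rule visits[OF that])
  then obtain q where q: "\<And>U. U \<in> \<U> \<Longrightarrow> q U > 0" "\<And>U. U \<in> \<U> \<Longrightarrow> visited U (q U)"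
    by metis
  \<comment> \<open>Half of the times have a bounded mean, so visits number at least
    \<open>2 * c * real t\<close> minus a logarithm, and half of that main term pays for the
    logarithm. The inserted 1 covers an empty family.\<close>
  define c where "c = Min (insert 1 (q ` \<U>)) / 4"
  have c: "c > 0" using fin q by (simp add: c_def)
  have cq: "4 * c \<le> q U" if "U \<in> \<U>" for U using fin that by (simp add: c_def)
  have "\<forall>\<^sub>F t in sequentially. \<forall>U\<in>\<U>. c * real t \<le> card {i. i < t \<and> y (Suc i) \<in> U}"
  proof (rule eventually_ball_finite[OF fin], rule ballI)
    fix U assume U: "U \<in> \<U>"
    have "\<forall>\<^sub>F t::nat in sequentially. c * real t \<le> 2 * c * real t - 2 * ln (real t + 1)"
      using c by real_asymp
    then show "\<forall>\<^sub>F t in sequentially. c * real t \<le> card {i. i < t \<and> y (Suc i) \<in> U}"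
      using q(2)[OF U, unfolded visited_def] K
    proof eventually_elim
      case (elim t)
      have "2 * c * real t = (4 * c) * (real t / 2)" by simp
      also have "\<dots> \<le> q U * card {i. i < t \<and> \<bar>mean i\<bar> \<le> real K}"
        using cq[OF U] c elim(3) by (intro mult_mono) auto
      finally have "c * real t \<le> card {i. i < t \<and> \<bar>mean i\<bar> \<le> real K \<and> y (Suc i) \<in> U}"
        using elim by linarith
      also have "\<dots> \<le> card {i. i < t \<and> y (Suc i) \<in> U}"
        by (intro of_nat_mono card_mono) auto
      finally show ?case .
    qed
  qed
  moreover have "\<forall>\<^sub>F t in sequentially. energy (Suc t) \<le>
    (norm (\<theta> - \<theta>0))\<^sup>2 + 2 * (\<Sum>i<Suc t. growth i) + 4 * ln (real (Suc t) + 1)"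
    using energy by (subst eventually_sequentially_Suc)
  moreover have "\<forall>\<^sub>F t::nat in sequentially. t \<ge> 1" by (rule eventually_ge_at_top)
  ultimately have "\<forall>\<^sub>F t in sequentially. norm ((norm (h (t + 1) - \<theta>))\<^sup>2) \<le> (1 / (c * (\<delta>\<^sup>2 / \<sigma>\<^sup>2))) *
    norm (((norm (\<theta> - \<theta>0))\<^sup>2 + 2 * (C' * ln (real t + 3)) + 4 * ln (real t + 2)) / real t)"
  proof eventually_elim
    case (elim t)
    define R where "R = (norm (\<theta> - \<theta>0))\<^sup>2 + 2 * (C' * ln (real t + 3)) + 4 * ln (real t + 2)"
    have c': "c * (\<delta>\<^sup>2 / \<sigma>\<^sup>2) > 0" using c \<delta> sigma_pos by simp
    have "(c * real t) * (\<delta>\<^sup>2 / \<sigma>\<^sup>2) * (norm (h (Suc t) - \<theta>))\<^sup>2 \<le> energy (Suc t)"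
      using elim(1) by (intro norm_error_sq_le_energy[OF \<delta> excite]) auto
    also have "\<dots> \<le> R" using elim(2) growth[of "Suc t"] by (simp add: R_def add_ac)
    finally have le: "(norm (h (Suc t) - \<theta>))\<^sup>2 * (c * (\<delta>\<^sup>2 / \<sigma>\<^sup>2)) \<le> R / real t"
      using elim(3) by (simp add: field_simps)
    then have "(norm (h (Suc t) - \<theta>))\<^sup>2 \<le> (R / real t) / (c * (\<delta>\<^sup>2 / \<sigma>\<^sup>2))"
      using c' by (subst pos_le_divide_eq)
    also have "\<dots> \<le> norm (R / real t) / (c * (\<delta>\<^sup>2 / \<sigma>\<^sup>2))"
      unfolding real_norm_def using c' by (intro divide_right_mono abs_ge_self) auto
    finally show ?case by (simp add: R_def mult_ac)
  qed
  then have "(\<lambda>t. (norm (h (t + 1) - \<theta>))\<^sup>2) \<in>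
    O(\<lambda>t. ((norm (\<theta> - \<theta>0))\<^sup>2 + 2 * (C' * ln (real t + 3)) + 4 * ln (real t + 2)) / real t)"
    by (rule bigoI)
  also have "(\<lambda>t::nat. ((norm (\<theta> - \<theta>0))\<^sup>2 + 2 * (C' * ln (real t + 3)) + 4 * ln (real t + 2)) / real t)
    \<in> O(\<lambda>t. ln (real t) / real t)"
    by real_asymp
  finally show ?thesis .
qed

end

section \<open>Nonnegative product processes\<close>

lemma borel_measurable_matrix_vector_mult [measurable (raw)]:
  fixes A :: "'a \<Rightarrow> real ^ 'n ^ 'm"
  assumes "A \<in> borel_measurable M" "x \<in> borel_measurable M"
  shows "(\<lambda>\<omega>. A \<omega> *v x \<omega>) \<in> borel_measurable M"
  using assms
  by (rule borel_measurable_continuous_Pair)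
    (unfold matrix_vector_mult_def, intro continuous_intros continuous_on_vec_lambda)

lemma borel_measurable_matrix_matrix_mult [measurable (raw)]:
  fixes A :: "'a \<Rightarrow> real ^ 'n ^ 'm" and B :: "'a \<Rightarrow> real ^ 'p ^ 'n"
  assumes "A \<in> borel_measurable M" "B \<in> borel_measurable M"
  shows "(\<lambda>\<omega>. A \<omega> ** B \<omega>) \<in> borel_measurable M"
  using assms
  by (rule borel_measurable_continuous_Pair)
    (unfold matrix_matrix_mult_def, intro continuous_intros continuous_on_vec_lambda)

lemma borel_measurable_outer_prod [measurable (raw)]:
  fixes x :: "'a \<Rightarrow> real ^ 'n"
  assumes "x \<in> borel_measurable M" "y \<in> borel_measurable M"
  shows "(\<lambda>\<omega>. outer_prod (x \<omega>) (y \<omega>)) \<in> borel_measurable M"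
  using assms
  by (rule borel_measurable_continuous_Pair)
    (unfold outer_prod_def, intro continuous_intros continuous_on_vec_lambda)

text \<open>Preimages under \<open>g \<circ> Y\<close> lie in the sigma algebra generated by
  \<open>Y\<close>, so the joint law factorizes on rectangles, which determine it.\<close>

lemma indep_rvs_joint_distr:
  assumes M: "prob_space M" and ind: "indep_rvs M N X K Y" and g: "g \<in> measurable K L"
  shows "distr M (N \<Otimes>\<^sub>M L) (\<lambda>\<omega>. (X \<omega>, g (Y \<omega>))) = distr M N X \<Otimes>\<^sub>M distr M L (\<lambda>\<omega>. g (Y \<omega>))"
proof -
  interpret prob_space M by fact
  have X [measurable]: "X \<in> measurable M N" and Y [measurable]: "Y \<in> measurable M K"
    using ind by (auto simp: indep_rvs_def)
  note g [measurable]
  have gY [measurable]: "(\<lambda>\<omega>. g (Y \<omega>)) \<in> measurable M L" by measurable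
  interpret X: prob_space "distr M N X" by (rule prob_space_distr) measurable
  interpret Y: prob_space "distr M L (\<lambda>\<omega>. g (Y \<omega>))" by (rule prob_space_distr) measurable
  show ?thesis
  proof (rule pair_measure_eqI[symmetric])
    show "sigma_finite_measure (distr M N X)" "sigma_finite_measure (distr M L (\<lambda>\<omega>. g (Y \<omega>)))"
      by unfold_locales
    show "sets (distr M N X \<Otimes>\<^sub>M distr M L (\<lambda>\<omega>. g (Y \<omega>))) = sets (distr M (N \<Otimes>\<^sub>M L) (\<lambda>\<omega>. (X \<omega>, g (Y \<omega>))))"
      by (simp cong: sets_pair_measure_cong)
    fix A B assume "A \<in> sets (distr M N X)" "B \<in> sets (distr M L (\<lambda>\<omega>. g (Y \<omega>)))"
    then have A: "A \<in> sets N" and B: "B \<in> sets L" by auto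
    have XA: "X -` A \<inter> space M \<in> sets (vimage_algebra (space M) X N)"
      by (rule in_vimage_algebra[OF A])
    have "(\<lambda>\<omega>. g (Y \<omega>)) -` B \<inter> space M = Y -` (g -` B \<inter> space K) \<inter> space M"
      using measurable_space[OF Y] by auto
    moreover have "g -` B \<inter> space K \<in> sets K" using g B by measurable
    ultimately have YB: "(\<lambda>\<omega>. g (Y \<omega>)) -` B \<inter> space M \<in> sets (vimage_algebra (space M) Y K)"
      by (simp only: in_vimage_algebra)
    have "prob ((X -` A \<inter> space M) \<inter> ((\<lambda>\<omega>. g (Y \<omega>)) -` B \<inter> space M)) =
      prob (X -` A \<inter> space M) * prob ((\<lambda>\<omega>. g (Y \<omega>)) -` B \<inter> space M)"
      using ind XA YB unfolding indep_rvs_def by (intro indep_setD) auto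
    moreover have "(\<lambda>\<omega>. (X \<omega>, g (Y \<omega>))) -` (A \<times> B) \<inter> space M =
      (X -` A \<inter> space M) \<inter> ((\<lambda>\<omega>. g (Y \<omega>)) -` B \<inter> space M)" by auto
    ultimately show "emeasure (distr M N X) A * emeasure (distr M L (\<lambda>\<omega>. g (Y \<omega>))) B =
      emeasure (distr M (N \<Otimes>\<^sub>M L) (\<lambda>\<omega>. (X \<omega>, g (Y \<omega>)))) (A \<times> B)"
      using A B by (simp add: emeasure_distr emeasure_eq_measure ennreal_mult[symmetric])
  qed
qed

text \<open>Markov's inequality bounds the exceptional probabilities by a summable sequence, and
  Borel-Cantelli applies. The events are indexed by \<open>Suc t\<close> because the integral bound
  starts at time 1.\<close>

lemma (in prob_space) AE_eventually_le_of_nn_integral_le_1: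
  assumes Z [measurable]: "\<And>t. Z t \<in> borel_measurable M"
    and int: "\<And>t. t \<ge> 1 \<Longrightarrow> (\<integral>\<^sup>+ \<omega>. Z t \<omega> \<partial>M) \<le> 1"
  shows "AE \<omega> in M. \<forall>\<^sub>F t in sequentially. Z t \<omega> \<le> ennreal ((real t + 1)\<^sup>2)"
proof -
  define A where "A t = {\<omega> \<in> space M. 1 \<le> ennreal (1 / (real t + 2)\<^sup>2) * Z (Suc t) \<omega>}" for t
  have A [measurable]: "A t \<in> sets M" for t unfolding A_def by measurable
  have A_le: "measure M (A t) \<le> 1 / (real t + 2)\<^sup>2" for t
  proof -
    have "emeasure M (A t) \<le> ennreal (1 / (real t + 2)\<^sup>2) * (\<integral>\<^sup>+ \<omega>. Z (Suc t) \<omega> * indicator (space M) \<omega> \<partial>M)"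
      unfolding A_def by (intro order_trans[OF _ nn_integral_Markov_inequality]) (auto intro!: emeasure_mono)
    also have "(\<integral>\<^sup>+ \<omega>. Z (Suc t) \<omega> * indicator (space M) \<omega> \<partial>M) = (\<integral>\<^sup>+ \<omega>. Z (Suc t) \<omega> \<partial>M)"
      by (intro nn_integral_cong) auto
    also have "ennreal (1 / (real t + 2)\<^sup>2) * \<dots> \<le> ennreal (1 / (real t + 2)\<^sup>2) * 1"
      by (intro mult_left_mono int) auto
    finally show ?thesis by (simp add: emeasure_eq_measure)
  qed
  have "summable (\<lambda>t. measure M (A t))"
  proof (rule summable_comparison_test')
    show "summable (\<lambda>t. inverse ((real (Suc t))\<^sup>2))"
      using inverse_power_summable[of 2, where 'a = real] by (subst summable_Suc_iff) auto
    show "norm (measure M (A t)) \<le> inverse ((real (Suc t))\<^sup>2)" for t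
    proof -
      have "1 / (real t + 2)\<^sup>2 \<le> 1 / (real (Suc t))\<^sup>2"
        by (intro divide_left_mono power_mono) auto
      then show ?thesis using A_le[of t] by (simp add: inverse_eq_divide)
    qed
  qed
  then have "AE \<omega> in M. \<forall>\<^sub>F t in sequentially. \<omega> \<in> space M - A t"
    by (intro borel_cantelli_AE1) (auto simp: emeasure_eq_measure)
  then show ?thesis
  proof eventually_elim
    case (elim \<omega>)
    have "\<forall>\<^sub>F t in sequentially. Z (Suc t) \<omega> \<le> ennreal ((real (Suc t) + 1)\<^sup>2)"
      using elim
    proof eventually_elim
      case (elim t)
      then have "ennreal (1 / (real t + 2)\<^sup>2) * Z (Suc t) \<omega> < 1" by (auto simp: A_def not_le)
      then show ?case
      proof (cases "Z (Suc t) \<omega>")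
        case (real r)
        then have "1 / (real t + 2)\<^sup>2 * r < 1"
          using \<open>ennreal (1 / (real t + 2)\<^sup>2) * Z (Suc t) \<omega> < 1\<close>
          by (simp add: ennreal_mult[symmetric] del: ennreal_1 add: ennreal_1[symmetric] ennreal_less_iff)
        then have "r \<le> (real (Suc t) + 1)\<^sup>2" by (simp add: field_simps add_ac)
        then show ?thesis using real by (simp add: ennreal_leI)
      qed (auto simp: ennreal_mult_top)
    qed
    then show ?case by (subst (asm) eventually_sequentially_Suc)
  qed
qed

section \<open>The closed loop as a function of parameter and noise\<close>

text \<open>The control is eliminated, so that the innovation equals the new output
  \<open>y'\<close>. The parameter is carried along in the state so that one-step weights may depend
  on it.\<close>

definition ls_step :: "real \<Rightarrow> (real \<Rightarrow> real ^ 'n) \<Rightarrow>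
    (real ^ 'n) \<times> (real ^ 'n) \<times> (real ^ 'n ^ 'n) \<times> real \<Rightarrow> real \<Rightarrow>
    (real ^ 'n) \<times> (real ^ 'n) \<times> (real ^ 'n ^ 'n) \<times> real" where
  "ls_step \<sigma> f = (\<lambda>(\<theta>, h, P, y) v.
     let \<phi> = f y;
         P' = P - inverse (\<sigma>\<^sup>2 + \<phi> \<bullet> (P *v \<phi>)) *\<^sub>R (P ** outer_prod \<phi> \<phi> ** P);
         y' = (\<theta> - h) \<bullet> \<phi> + v
     in (\<theta>, h + (inverse (\<sigma>\<^sup>2) * y') *\<^sub>R (P' *v \<phi>), P', y'))"

primrec ls_state :: "real \<Rightarrow> real ^ 'n \<Rightarrow> (real \<Rightarrow> real ^ 'n) \<Rightarrow> real \<Rightarrow> real ^ 'n \<Rightarrow> (nat \<Rightarrow> real) \<Rightarrow>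
    nat \<Rightarrow> (real ^ 'n) \<times> (real ^ 'n) \<times> (real ^ 'n ^ 'n) \<times> real" where
  "ls_state \<sigma> \<theta>0 f y0 \<theta> W 0 = (\<theta>, \<theta>0, mat 1, y0)"
| "ls_state \<sigma> \<theta>0 f y0 \<theta> W (Suc t) = ls_step \<sigma> f (ls_state \<sigma> \<theta>0 f y0 \<theta> W t) (W (Suc t))"

lemma (in ls_loop) ls_state_eq: "ls_state \<sigma> \<theta>0 f y0 \<theta> w t = (\<theta>, h t, P t, y t)"
proof (induction t)
  case 0
  show ?case by (simp add: h_0 P_0 y_0)
next
  case (Suc t)
  have "y (Suc t) = (\<theta> - h t) \<bullet> f (y t) + w (Suc t)" by (simp add: y_Suc mean_def)
  with Suc show ?case
    by (simp add: ls_step_def Let_def h_Suc P_Suc var_def u_eq inner_commute)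
qed

lemma ls_state_cong:
  "(\<And>i. 1 \<le> i \<Longrightarrow> i \<le> t \<Longrightarrow> W i = W' i) \<Longrightarrow> ls_state \<sigma> \<theta>0 f y0 \<theta> W t = ls_state \<sigma> \<theta>0 f y0 \<theta> W' t"
  by (induction t) auto

lemma measurable_ls_step:
  fixes f :: "real \<Rightarrow> real ^ 'n"
  assumes [measurable]: "f \<in> borel_measurable borel"
    and [measurable]: "s \<in> borel_measurable M" "v \<in> borel_measurable M"
  shows "(\<lambda>x. ls_step \<sigma> f (s x) (v x)) \<in> borel_measurable M"
proof -
  have s: "(\<lambda>x. fst (s x)) \<in> borel_measurable M" "(\<lambda>x. fst (snd (s x))) \<in> borel_measurable M"
    "(\<lambda>x. fst (snd (snd (s x)))) \<in> borel_measurable M" "(\<lambda>x. snd (snd (snd (s x)))) \<in> borel_measurable M"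
    unfolding borel_prod[symmetric] using assms(2) by (simp_all add: borel_prod[symmetric])
  note [measurable] = s
  have "ls_step \<sigma> f (s x) (v x) = ls_step \<sigma> f (fst (s x), fst (snd (s x)), fst (snd (snd (s x))), snd (snd (snd (s x)))) (v x)" for x
    by simp
  then show ?thesis
    unfolding ls_step_def Let_def prod.case by (simp del: prod.collapse) measurable
qed

lemma measurable_ls_state:
  fixes f :: "real \<Rightarrow> real ^ 'n"
  assumes f: "f \<in> borel_measurable borel" and "i \<le> t"
  shows "(\<lambda>x. ls_state \<sigma> \<theta>0 f y0 (fst x) (snd x) i) \<in>
    borel_measurable (borel \<Otimes>\<^sub>M PiM {1..t} (\<lambda>_. borel))"
  using \<open>i \<le> t\<close>
proof (induction i)
  case 0
  show ?case unfolding ls_state.simps borel_prod[symmetric] by measurable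
next
  case (Suc i)
  have "(\<lambda>x. snd x (Suc i)) \<in> borel_measurable (borel \<Otimes>\<^sub>M PiM {1..t} (\<lambda>_. borel :: real measure))"
    using Suc.prems by (intro measurable_compose[OF measurable_snd measurable_component_singleton]) auto
  with Suc show ?case unfolding ls_state.simps by (intro measurable_ls_step f) auto
qed

locale ls_stochastic_loop = prob_space M for M :: "'a measure" +
  fixes \<sigma> :: real and \<theta>0 :: "real ^ 'n" and f :: "real \<Rightarrow> real ^ 'n" and y0 :: real
    and \<theta> :: "'a \<Rightarrow> real ^ 'n" and w y u :: "nat \<Rightarrow> 'a \<Rightarrow> real" and h :: "nat \<Rightarrow> 'a \<Rightarrow> real ^ 'n"
    and P :: "nat \<Rightarrow> 'a \<Rightarrow> real ^ 'n ^ 'n"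
  assumes sigma_pos: "\<sigma> > 0"
    and f_meas: "f \<in> borel_measurable borel"
    and noise_indep: "indep_vars (\<lambda>_. borel) w {1..}"
    and noise_law: "\<And>t. t \<ge> 1 \<Longrightarrow> distr M borel (w t) = density lborel (normal_density 0 \<sigma>)"
    and param_indep: "indep_rvs M borel \<theta> (PiM {1..} (\<lambda>_. borel)) (\<lambda>\<omega>. \<lambda>t\<in>{1..}. w t \<omega>)"
    and loop: "\<And>\<omega>. \<omega> \<in> space M \<Longrightarrow>
      ls_closed_loop \<sigma> \<theta>0 f y0 (\<theta> \<omega>) (\<lambda>t. w t \<omega>)
        (\<lambda>t. y t \<omega>) (\<lambda>t. u t \<omega>) (\<lambda>t. h t \<omega>) (\<lambda>t. P t \<omega>)"
begin

text \<open>Turns expectations over \<open>M\<close> into iterated integrals. Positive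
  \<open>t\<close> keeps the index set of the noise nonempty.\<close>

lemma distr_param_noise:
  assumes "t \<ge> 1"
  shows "distr M (borel \<Otimes>\<^sub>M PiM {1..t} (\<lambda>_. borel)) (\<lambda>\<omega>. (\<theta> \<omega>, \<lambda>i\<in>{1..t}. w i \<omega>)) =
    distr M borel \<theta> \<Otimes>\<^sub>M PiM {1..t} (\<lambda>_. density lborel (normal_density 0 \<sigma>))"
proof -
  have sub: "{1..t} \<subseteq> {1::nat..}" by auto
  have ind: "indep_vars (\<lambda>_. borel) w {1..t}"
    using noise_indep sub by (rule indep_vars_subset)
  have "distr M (PiM {1..t} (\<lambda>_. borel)) (\<lambda>\<omega>. \<lambda>i\<in>{1..t}. w i \<omega>) = PiM {1..t} (\<lambda>i. distr M borel (w i))"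
  proof (rule indep_vars_iff_distr_eq_PiM'[THEN iffD1, OF _ _ ind])
    show "random_variable borel (w i)" if "i \<in> {1..t}" for i
      using ind that unfolding indep_vars_def by blast
  qed (use \<open>t \<ge> 1\<close> in auto)
  also have "\<dots> = PiM {1..t} (\<lambda>_. density lborel (normal_density 0 \<sigma>))"
    by (intro PiM_cong noise_law) auto
  finally have law: "distr M (PiM {1..t} (\<lambda>_. borel)) (\<lambda>\<omega>. \<lambda>i\<in>{1..t}. w i \<omega>) =
    PiM {1..t} (\<lambda>_. density lborel (normal_density 0 \<sigma>))" .
  have restr: "restrict (\<lambda>t\<in>{1..}. w t \<omega>) {1..t} = (\<lambda>i\<in>{1..t}. w i \<omega>)" for \<omega> by (auto simp: restrict_def)
  show ?thesis
    using indep_rvs_joint_distr[OF prob_space_axioms param_indep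
        measurable_restrict_subset[OF sub, of "\<lambda>_. borel"]]
    unfolding restr law .
qed

text \<open>The product is a nonnegative process whose expectation does not increase, since each
  factor has conditional expectation at most 1 given the past.\<close>

lemma AE_eventually_prod_le:
  fixes g :: "(real ^ 'n) \<times> (real ^ 'n) \<times> (real ^ 'n ^ 'n) \<times> real \<Rightarrow> real \<Rightarrow> ennreal"
  assumes g: "(\<lambda>x. g (fst x) (snd x)) \<in> borel_measurable (borel \<Otimes>\<^sub>M borel)"
    and int: "\<And>s. (\<integral>\<^sup>+ v. g s v \<partial>density lborel (normal_density 0 \<sigma>)) \<le> 1"
  shows "AE \<omega> in M. \<forall>\<^sub>F t in sequentially.
    (\<Prod>i<t. g (\<theta> \<omega>, h i \<omega>, P i \<omega>, y i \<omega>) (w (Suc i) \<omega>)) \<le> ennreal ((real t + 1)\<^sup>2)"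
proof -
  define N where "N = density lborel (normal_density 0 \<sigma>)"
  interpret N: prob_space N unfolding N_def by (rule prob_space_normal_density[OF sigma_pos])
  have sets_N [measurable_cong]: "sets N = sets borel" by (simp add: N_def)
  interpret N: product_sigma_finite "\<lambda>_::nat. N" ..
  have prob_PiM: "prob_space (PiM I (\<lambda>_::nat. N))" for I by (intro prob_space_PiM N.prob_space_axioms)
  have sets_PiM_N: "sets (PiM I (\<lambda>_::nat. N)) = sets (PiM I (\<lambda>_. borel))" for I
    by (intro sets_PiM_cong) (auto simp: sets_N)
  define Z where "Z t x = (\<Prod>i<t. g (ls_state \<sigma> \<theta>0 f y0 (fst x) (snd x) i) (snd x (Suc i)))" for t x
  have Z_meas: "Z t \<in> borel_measurable (borel \<Otimes>\<^sub>M PiM {1..t} (\<lambda>_. borel))" for t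
    unfolding Z_def
  proof (rule borel_measurable_prod_ennreal)
    fix i assume i: "i \<in> {..<t}"
    have "(\<lambda>x. ls_state \<sigma> \<theta>0 f y0 (fst x) (snd x) i) \<in> borel_measurable (borel \<Otimes>\<^sub>M PiM {1..t} (\<lambda>_. borel))"
      using i by (intro measurable_ls_state f_meas) auto
    moreover have "(\<lambda>x. snd x (Suc i)) \<in> borel_measurable (borel \<Otimes>\<^sub>M PiM {1..t} (\<lambda>_. borel :: real measure))"
      using i by (intro measurable_compose[OF measurable_snd measurable_component_singleton]) auto
    ultimately show "(\<lambda>x. g (ls_state \<sigma> \<theta>0 f y0 (fst x) (snd x) i) (snd x (Suc i))) \<in>
      borel_measurable (borel \<Otimes>\<^sub>M PiM {1..t} (\<lambda>_. borel))"
      using measurable_compose[OF measurable_Pair g] by simp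
  qed
  have Z_meas2: "(\<lambda>W. Z t (p, W)) \<in> borel_measurable (PiM {1..t} (\<lambda>_. N))" for t p
    unfolding measurable_cong_sets[OF sets_PiM_N refl]
    by (rule measurable_compose[OF measurable_Pair1' Z_meas]) simp
  \<comment> \<open>For a fixed parameter \<open>p\<close> the newest noise is integrated out first;
    the earlier factors do not depend on it.\<close>
  have J: "(\<integral>\<^sup>+ W. Z t (p, W) \<partial>PiM {1..t} (\<lambda>_. N)) \<le> 1" for t p
  proof (induction t)
    case 0
    interpret E: prob_space "PiM {1..0::nat} (\<lambda>_. N)" by (rule prob_PiM)
    show ?case using E.emeasure_space_1 by (simp add: Z_def)
  next
    case (Suc t)
    have ins: "{1..Suc t} = insert (Suc t) {1..t}" by auto
    have "(\<integral>\<^sup>+ W. Z (Suc t) (p, W) \<partial>PiM {1..Suc t} (\<lambda>_. N)) =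
      (\<integral>\<^sup>+ W. (\<integral>\<^sup>+ v. Z (Suc t) (p, W(Suc t := v)) \<partial>N) \<partial>PiM {1..t} (\<lambda>_. N))"
      using Z_meas2[of "Suc t" p] unfolding ins
      by (intro N.product_nn_integral_insert) auto
    also have "\<dots> \<le> (\<integral>\<^sup>+ W. Z t (p, W) \<partial>PiM {1..t} (\<lambda>_. N))"
    proof (rule nn_integral_mono)
      fix W
      define s where "s = ls_state \<sigma> \<theta>0 f y0 p W t"
      have st: "ls_state \<sigma> \<theta>0 f y0 p (W(Suc t := v)) i = ls_state \<sigma> \<theta>0 f y0 p W i" if "i \<le> t" for i v
        using that by (intro ls_state_cong) auto
      have "Z (Suc t) (p, W(Suc t := v)) = Z t (p, W) * g s v" for v
        unfolding Z_def by (simp add: st s_def)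
      moreover have "(\<lambda>v. g s v) \<in> borel_measurable N"
        unfolding measurable_cong_sets[OF sets_N refl]
        using measurable_compose[OF measurable_Pair1' g, of s] by simp
      ultimately have "(\<integral>\<^sup>+ v. Z (Suc t) (p, W(Suc t := v)) \<partial>N) = Z t (p, W) * (\<integral>\<^sup>+ v. g s v \<partial>N)"
        by (simp add: nn_integral_cmult)
      also have "\<dots> \<le> Z t (p, W) * 1" by (intro mult_left_mono) (use int in \<open>auto simp: N_def\<close>)
      finally show "(\<integral>\<^sup>+ v. Z (Suc t) (p, W(Suc t := v)) \<partial>N) \<le> Z t (p, W)" by simp
    qed
    finally show ?case using Suc by simp
  qed
  have \<theta>_meas: "\<theta> \<in> borel_measurable M" using param_indep by (simp add: indep_rvs_def)
  interpret \<theta>: prob_space "distr M borel \<theta>" by (rule prob_space_distr[OF \<theta>_meas])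
  have w_meas: "w i \<in> borel_measurable M" if "i \<ge> 1" for i
    using noise_indep that by (auto simp: indep_vars_def)
  have pair_meas: "(\<lambda>\<omega>. (\<theta> \<omega>, \<lambda>i\<in>{1..t}. w i \<omega>)) \<in> M \<rightarrow>\<^sub>M borel \<Otimes>\<^sub>M PiM {1..t} (\<lambda>_. borel)" for t
    by (intro measurable_Pair \<theta>_meas measurable_restrict w_meas) auto
  have "AE \<omega> in M. \<forall>\<^sub>F t in sequentially. Z t (\<theta> \<omega>, \<lambda>i\<in>{1..t}. w i \<omega>) \<le> ennreal ((real t + 1)\<^sup>2)"
  proof (rule AE_eventually_le_of_nn_integral_le_1)
    show "(\<lambda>\<omega>. Z t (\<theta> \<omega>, \<lambda>i\<in>{1..t}. w i \<omega>)) \<in> borel_measurable M" for t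
      by (rule measurable_compose[OF pair_meas Z_meas])
    fix t :: nat assume t: "t \<ge> 1"
    interpret E: prob_space "PiM {1..t} (\<lambda>_. N)" by (rule prob_PiM)
    have "(\<integral>\<^sup>+ \<omega>. Z t (\<theta> \<omega>, \<lambda>i\<in>{1..t}. w i \<omega>) \<partial>M) =
      (\<integral>\<^sup>+ x. Z t x \<partial>distr M (borel \<Otimes>\<^sub>M PiM {1..t} (\<lambda>_. borel)) (\<lambda>\<omega>. (\<theta> \<omega>, \<lambda>i\<in>{1..t}. w i \<omega>)))"
      by (subst nn_integral_distr[OF pair_meas]) (simp_all only: measurable_distr_eq1 Z_meas)
    also have "\<dots> = (\<integral>\<^sup>+ x. Z t x \<partial>(distr M borel \<theta> \<Otimes>\<^sub>M PiM {1..t} (\<lambda>_. N)))"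
      unfolding distr_param_noise[OF t] N_def ..
    also have "\<dots> = (\<integral>\<^sup>+ p. (\<integral>\<^sup>+ W. Z t (p, W) \<partial>PiM {1..t} (\<lambda>_. N)) \<partial>distr M borel \<theta>)"
    proof (rule E.nn_integral_fst[symmetric])
      show "Z t \<in> borel_measurable (distr M borel \<theta> \<Otimes>\<^sub>M PiM {1..t} (\<lambda>_. N))"
        using Z_meas[of t]
        by (subst measurable_cong_sets[OF sets_pair_measure_cong[OF sets_distr sets_PiM_N] refl])
    qed
    also have "\<dots> \<le> (\<integral>\<^sup>+ p. 1 \<partial>distr M borel \<theta>)" by (intro nn_integral_mono J)
    also have "\<dots> = 1" using \<theta>.emeasure_space_1 by simp
    finally show "(\<integral>\<^sup>+ \<omega>. Z t (\<theta> \<omega>, \<lambda>i\<in>{1..t}. w i \<omega>) \<partial>M) \<le> 1" .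
  qed
  \<comment> \<open>Along a sample path the recursion reproduces the given estimates, matrices and
    outputs.\<close>
  moreover have "Z t (\<theta> \<omega>, \<lambda>i\<in>{1..t}. w i \<omega>) = (\<Prod>i<t. g (\<theta> \<omega>, h i \<omega>, P i \<omega>, y i \<omega>) (w (Suc i) \<omega>))"
    if \<omega>: "\<omega> \<in> space M" for t \<omega>
  proof -
    interpret L: ls_loop \<sigma> \<theta>0 f y0 "\<theta> \<omega>" "\<lambda>t. w t \<omega>" "\<lambda>t. y t \<omega>" "\<lambda>t. u t \<omega>" "\<lambda>t. h t \<omega>" "\<lambda>t. P t \<omega>"
      by unfold_locales (use sigma_pos loop[OF \<omega>] in auto)
    have "ls_state \<sigma> \<theta>0 f y0 (\<theta> \<omega>) (\<lambda>i\<in>{1..t}. w i \<omega>) i = (\<theta> \<omega>, h i \<omega>, P i \<omega>, y i \<omega>)" if "i < t" for i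
      unfolding L.ls_state_eq[symmetric] using that by (intro ls_state_cong) auto
    then show ?thesis unfolding Z_def by (intro prod.cong) auto
  qed
  ultimately show ?thesis by (simp cong: AE_cong)
qed

end

section \<open>One-step ratios with integral at most one\<close>

lemma nn_integral_normal_density_ratio:
  assumes "s > 0" "\<sigma> > 0"
  shows "(\<integral>\<^sup>+ v. ennreal (normal_density \<mu> s v / normal_density 0 \<sigma> v) \<partial>density lborel (normal_density 0 \<sigma>)) = 1"
proof -
  have "(\<integral>\<^sup>+ v. ennreal (normal_density \<mu> s v / normal_density 0 \<sigma> v) \<partial>density lborel (normal_density 0 \<sigma>)) =
    (\<integral>\<^sup>+ v. ennreal (normal_density 0 \<sigma> v) * ennreal (normal_density \<mu> s v / normal_density 0 \<sigma> v) \<partial>lborel)"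
    by (rule nn_integral_density) auto
  also have "\<dots> = (\<integral>\<^sup>+ v. ennreal (normal_density \<mu> s v) \<partial>lborel)"
  proof (rule nn_integral_cong)
    fix v
    have "normal_density 0 \<sigma> v > 0" by (rule normal_density_pos[OF assms(2)])
    then show "ennreal (normal_density 0 \<sigma> v) * ennreal (normal_density \<mu> s v / normal_density 0 \<sigma> v) = ennreal (normal_density \<mu> s v)"
      by (simp add: ennreal_mult[symmetric])
  qed
  also have "\<dots> = emeasure (density lborel (normal_density \<mu> s)) (space (density lborel (normal_density \<mu> s)))"
    by (simp add: emeasure_density)
  also have "\<dots> = 1"
    by (rule prob_space.emeasure_space_1[OF prob_space_normal_density[OF assms(1)]])
  finally show ?thesis .
qed

lemma normal_density_antimono:
  assumes "\<bar>v\<bar> \<le> R" "\<sigma> > 0"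
  shows "normal_density 0 \<sigma> R \<le> normal_density 0 \<sigma> v"
proof -
  have "v\<^sup>2 \<le> R\<^sup>2" using power_mono[OF assms(1), of 2] by simp
  then show ?thesis using assms(2) unfolding normal_density_def
    by (intro mult_left_mono) (auto intro!: divide_right_mono)
qed

text \<open>The set is an interval of length \<open>2 * r\<close> whose points have modulus at most
  \<open>\<bar>a\<bar> + r + K\<close>; there the density is at least its value at that
  bound.\<close>

lemma normal_ball_lower_bound:
  fixes a r m K \<sigma> :: real
  assumes "\<sigma> > 0" "r > 0" "\<bar>m\<bar> \<le> K"
  shows "2 * r * normal_density 0 \<sigma> (\<bar>a\<bar> + r + K) \<le>
    measure (density lborel (normal_density 0 \<sigma>)) {v. m + v \<in> ball a r}"
proof -
  interpret prob_space "density lborel (normal_density 0 \<sigma>)"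
    by (rule prob_space_normal_density[OF assms(1)])
  define c where "c = normal_density 0 \<sigma> (\<bar>a\<bar> + r + K)"
  have c: "c \<ge> 0" by (simp add: c_def)
  have eq: "{v. m + v \<in> ball a r} = {a - m - r <..< a - m + r}" by (auto simp: dist_real_def)
  have "ennreal (2 * r * c) = ennreal c * emeasure lborel {a - m - r <..< a - m + r}"
    using assms c by (simp add: ennreal_mult[symmetric] mult_ac)
  also have "\<dots> = (\<integral>\<^sup>+ v. ennreal c * indicator {a - m - r <..< a - m + r} v \<partial>lborel)"
    by (simp add: nn_integral_cmult)
  also have "\<dots> \<le> (\<integral>\<^sup>+ v. ennreal (normal_density 0 \<sigma> v) * indicator {a - m - r <..< a - m + r} v \<partial>lborel)"
  proof (rule nn_integral_mono)
    fix v
    show "ennreal c * indicator {a - m - r <..< a - m + r} v \<le>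
      ennreal (normal_density 0 \<sigma> v) * indicator {a - m - r <..< a - m + r} v"
      using normal_density_antimono[of v "\<bar>a\<bar> + r + K" \<sigma>] assms
      by (auto simp: indicator_def c_def intro!: ennreal_leI)
  qed
  also have "\<dots> = emeasure (density lborel (normal_density 0 \<sigma>)) {v. m + v \<in> ball a r}"
    unfolding eq by (subst emeasure_density) auto
  finally show ?thesis by (simp add: emeasure_eq_measure c_def)
qed

text \<open>The integral is \<open>exp q\<close> times
  \<open>1 - (1 - exp (-1)) * measure N A\<close>, hence at most \<open>exp q * (1 - q)\<close>, and
  \<open>1 - q \<le> exp (- q)\<close>.\<close>

lemma nn_integral_visit_weight_le_1:
  fixes q p m :: real
  assumes "\<sigma> > 0" and A: "A \<in> sets borel" and p: "p \<le> measure (density lborel (normal_density 0 \<sigma>)) A"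
    and q: "q = (1 - exp (-1)) * p"
  shows "(\<integral>\<^sup>+ v. ennreal (exp (q - indicator A v)) \<partial>density lborel (normal_density 0 \<sigma>)) \<le> 1"
proof -
  define N where "N = density lborel (normal_density 0 \<sigma>)"
  interpret N: prob_space N unfolding N_def by (rule prob_space_normal_density[OF assms(1)])
  have A' [measurable]: "A \<in> sets N" using A by (simp add: N_def)
  have eq: "exp (q - indicator A v) = exp q - exp q * (1 - exp (-1)) * indicator A v" for v :: real
    by (auto simp: indicator_def exp_diff exp_minus field_simps)
  have "(\<integral>\<^sup>+ v. ennreal (exp (q - indicator A v)) \<partial>N) = ennreal (\<integral> v. exp (q - indicator A v) \<partial>N)"
  proof (rule nn_integral_eq_integral)
    show "integrable N (\<lambda>v. exp (q - indicator A v))"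
      unfolding eq by (auto simp: N.emeasure_eq_measure)
  qed simp
  also have "(\<integral> v. exp (q - indicator A v) \<partial>N) = exp q * (1 - (1 - exp (-1)) * measure N A)"
    unfolding eq by (subst Bochner_Integration.integral_diff) (auto simp: N.prob_space N.emeasure_eq_measure algebra_simps)
  also have "ennreal \<dots> \<le> ennreal (exp q * (1 - q))"
    using p unfolding q N_def by (intro ennreal_leI mult_left_mono diff_left_mono) auto
  also have "\<dots> \<le> ennreal (exp q * exp (- q))"
    using exp_ge_add_one_self[of "- q"] by (intro ennreal_leI mult_left_mono) auto
  also have "\<dots> = 1" by (simp add: exp_minus)
  finally show ?thesis unfolding N_def .
qed

text \<open>Likelihood ratio of doubled to true noise variance. Its logarithm is quadratic in
  \<open>v\<close>, so a bound on the product bounds the sum of squared noises.\<close>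

definition noise_ratio :: "real \<Rightarrow> real \<Rightarrow> ennreal" where
  "noise_ratio \<sigma> v = ennreal (normal_density 0 (sqrt 2 * \<sigma>) v / normal_density 0 \<sigma> v)"

text \<open>Likelihood ratio of the one-step Bayesian predictive law \<open>N(0, var)\<close> of the observation to
  its law \<open>N(mean, \<sigma>\<^sup>2)\<close> given the parameter. The maximum only matters for unreachable states.\<close>

definition innovation_ratio :: "real \<Rightarrow> (real \<Rightarrow> real ^ 'n) \<Rightarrow>
    (real ^ 'n) \<times> (real ^ 'n) \<times> (real ^ 'n ^ 'n) \<times> real \<Rightarrow> real \<Rightarrow> ennreal" where
  "innovation_ratio \<sigma> f = (\<lambda>(\<theta>, h, P, y) v.
     ennreal (normal_density (- ((\<theta> - h) \<bullet> f y)) (sqrt (max (\<sigma>\<^sup>2) (\<sigma>\<^sup>2 + f y \<bullet> (P *v f y)))) v /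
       normal_density 0 \<sigma> v))"

text \<open>An exponential weight that gains \<open>q\<close> in the exponent whenever the mean is
  bounded by \<open>K\<close> and loses 1 when the output then lands in \<open>U\<close>; a bounded
  product forces many visits.\<close>

definition visit_weight :: "real \<Rightarrow> real \<Rightarrow> real set \<Rightarrow> (real \<Rightarrow> real ^ 'n) \<Rightarrow>
    (real ^ 'n) \<times> (real ^ 'n) \<times> (real ^ 'n ^ 'n) \<times> real \<Rightarrow> real \<Rightarrow> ennreal" where
  "visit_weight q K U f = (\<lambda>(\<theta>, h, P, y) v.
     if \<bar>(\<theta> - h) \<bullet> f y\<bar> \<le> K then ennreal (exp (q - indicator {v. (\<theta> - h) \<bullet> f y + v \<in> U} v)) else 1)"

lemma normal_density_ratio:
  assumes "s > 0" "\<sigma> > 0"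
  shows "normal_density \<mu> s v / normal_density 0 \<sigma> v =
    \<sigma> / s * exp (v\<^sup>2 / (2 * \<sigma>\<^sup>2) - (v - \<mu>)\<^sup>2 / (2 * s\<^sup>2))"
proof -
  define A where "A = (v - \<mu>)\<^sup>2 / (2 * s\<^sup>2)"
  define B where "B = v\<^sup>2 / (2 * \<sigma>\<^sup>2)"
  have eqs: "normal_density \<mu> s v = exp (- A) / (sqrt (2 * pi) * s)"
    "normal_density 0 \<sigma> v = exp (- B) / (sqrt (2 * pi) * \<sigma>)"
    using assms by (simp_all add: normal_density_def A_def B_def real_sqrt_mult)
  show ?thesis
    unfolding A_def[symmetric] B_def[symmetric] eqs using assms
    by (simp add: exp_diff exp_minus field_simps)
qed

section \<open>Pathwise consequences of the product bounds\<close>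

context ls_loop begin

lemma noise_bound_of_prod:
  assumes "\<forall>\<^sub>F t in sequentially. (\<Prod>i<t. noise_ratio \<sigma> (w (Suc i))) \<le> ennreal ((real t + 1)\<^sup>2)"
  shows "\<exists>C. \<forall>t. (\<Sum>i<t. (w (Suc i))\<^sup>2) \<le> C * (real t + 1)"
proof -
  have ratio: "noise_ratio \<sigma> v = ennreal (exp (v\<^sup>2 / (4 * \<sigma>\<^sup>2) - ln 2 / 2))" for v
  proof -
    have "exp (ln 2 / 2) = sqrt (2::real)" by (simp add: ln_sqrt[symmetric])
    moreover have "v\<^sup>2 / (2 * \<sigma>\<^sup>2) - v\<^sup>2 / (2 * (sqrt 2 * \<sigma>)\<^sup>2) = v\<^sup>2 / (4 * \<sigma>\<^sup>2)"
      using sigma_pos by (simp add: power_mult_distrib field_simps)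
    ultimately show ?thesis
      using sigma_pos normal_density_ratio[of "sqrt 2 * \<sigma>" \<sigma> 0 v]
      by (simp add: noise_ratio_def exp_diff exp_minus inverse_eq_divide)
  qed
  have "\<forall>\<^sub>F t in sequentially. (\<Sum>i<t. (w (Suc i))\<^sup>2) \<le> 12 * \<sigma>\<^sup>2 * (real t + 1)"
    using assms
  proof eventually_elim
    case (elim t)
    have "(\<Prod>i<t. noise_ratio \<sigma> (w (Suc i))) =
      ennreal (exp (\<Sum>i<t. (w (Suc i))\<^sup>2 / (4 * \<sigma>\<^sup>2) - ln 2 / 2))"
      by (simp add: ratio prod_ennreal exp_sum)
    with elim have "exp (\<Sum>i<t. (w (Suc i))\<^sup>2 / (4 * \<sigma>\<^sup>2) - ln 2 / 2) \<le> (real t + 1)\<^sup>2"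
      by (simp add: ennreal_le_iff)
    then have "(\<Sum>i<t. (w (Suc i))\<^sup>2 / (4 * \<sigma>\<^sup>2) - ln 2 / 2) \<le> ln ((real t + 1)\<^sup>2)"
      by (subst ln_ge_iff) auto
    also have "\<dots> = 2 * ln (real t + 1)" by (simp add: ln_realpow)
    also have "\<dots> \<le> 2 * (real t + 1)" using ln_le_minus_one[of "real t + 1"] by simp
    finally have "(\<Sum>i<t. (w (Suc i))\<^sup>2) / (4 * \<sigma>\<^sup>2) \<le> 2 * (real t + 1) + real t * (ln 2 / 2)"
      by (simp add: sum_subtractf sum_divide_distrib)
    also have "real t * (ln 2 / 2) \<le> real t * 1"
      using ln_le_minus_one[of 2] by (intro mult_left_mono) auto
    finally have "(\<Sum>i<t. (w (Suc i))\<^sup>2) / (4 * \<sigma>\<^sup>2) \<le> 3 * (real t + 1)" by simp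
    then show ?case using sigma_pos by (simp add: field_simps)
  qed
  then obtain T where T: "\<And>t. t \<ge> T \<Longrightarrow> (\<Sum>i<t. (w (Suc i))\<^sup>2) \<le> 12 * \<sigma>\<^sup>2 * (real t + 1)"
    unfolding eventually_sequentially by blast
  \<comment> \<open>The second entry covers the finitely many times before \<open>T\<close>.\<close>
  define C where "C = max (12 * \<sigma>\<^sup>2) (\<Sum>i<T. (w (Suc i))\<^sup>2)"
  have "(\<Sum>i<t. (w (Suc i))\<^sup>2) \<le> C * (real t + 1)" for t
  proof (cases "t \<ge> T")
    case True
    have "12 * \<sigma>\<^sup>2 * (real t + 1) \<le> C * (real t + 1)"
      by (intro mult_right_mono) (auto simp: C_def)
    then show ?thesis using T[OF True] by linarith
  next
    case False
    have "(\<Sum>i<t. (w (Suc i))\<^sup>2) \<le> (\<Sum>i<T. (w (Suc i))\<^sup>2)"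
      using False by (intro sum_mono2) auto
    also have "\<dots> \<le> C" by (simp add: C_def)
    also have "\<dots> \<le> C * (real t + 1)"
      using mult_left_mono[of 1 "real t + 1" C] by (simp add: C_def max.coboundedI1)
    finally show ?thesis .
  qed
  then show ?thesis by blast
qed

text \<open>The logarithm of the product is half the normalized noise energy minus half the sum of
  normalized squared outputs minus the growth; the energy identity replaces the difference of the
  first two.\<close>

lemma energy_bound_of_prod:
  assumes "(\<Prod>i<t. innovation_ratio \<sigma> f (\<theta>, h i, P i, y i) (w (Suc i))) \<le> ennreal ((real t + 1)\<^sup>2)"
  shows "energy t \<le> (norm (\<theta> - \<theta>0))\<^sup>2 + 2 * (\<Sum>i<t. growth i) + 4 * ln (real t + 1)"
proof -
  define E where "E i = (w (Suc i))\<^sup>2 / (2 * \<sigma>\<^sup>2) - (y (Suc i))\<^sup>2 / var i / 2 - growth i" for i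
  have ratio: "innovation_ratio \<sigma> f (\<theta>, h i, P i, y i) (w (Suc i)) = ennreal (exp (E i))" for i
  proof -
    define s where "s = sqrt (var i)"
    have s: "s > 0" using var_pos by (simp add: s_def)
    have s2: "s\<^sup>2 = var i" using var_pos[of i] by (simp add: s_def)
    have "s = \<sigma> * exp (growth i)"
      unfolding s_def var_eq using sigma_pos
      by (intro real_sqrt_unique) (auto simp: power_mult_distrib simp flip: exp_of_nat_mult)
    then have exp_growth: "exp (growth i) = s / \<sigma>" using sigma_pos by simp
    have max: "max (\<sigma>\<^sup>2) (\<sigma>\<^sup>2 + f (y i) \<bullet> (P i *v f (y i))) = var i"
      using var_ge[of i] by (simp add: var_def)
    have "innovation_ratio \<sigma> f (\<theta>, h i, P i, y i) (w (Suc i)) =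
      ennreal (normal_density (- mean i) s (w (Suc i)) / normal_density 0 \<sigma> (w (Suc i)))"
      by (simp add: innovation_ratio_def max s_def mean_def[symmetric])
    also have "normal_density (- mean i) s (w (Suc i)) / normal_density 0 \<sigma> (w (Suc i)) =
      \<sigma> / s * exp ((w (Suc i))\<^sup>2 / (2 * \<sigma>\<^sup>2) - (y (Suc i))\<^sup>2 / (2 * s\<^sup>2))"
      using normal_density_ratio[OF s sigma_pos] by (simp add: y_Suc add.commute)
    also have "\<dots> = exp (E i)"
      unfolding E_def s2 using s sigma_pos by (simp add: exp_diff exp_growth mult_ac)
    finally show ?thesis .
  qed
  have "(\<Prod>i<t. innovation_ratio \<sigma> f (\<theta>, h i, P i, y i) (w (Suc i))) = ennreal (exp (\<Sum>i<t. E i))"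
    by (simp add: ratio prod_ennreal exp_sum)
  with assms have "exp (\<Sum>i<t. E i) \<le> (real t + 1)\<^sup>2" by (simp add: ennreal_le_iff)
  then have "(\<Sum>i<t. E i) \<le> ln ((real t + 1)\<^sup>2)" by (subst ln_ge_iff) auto
  also have "\<dots> = 2 * ln (real t + 1)" by (simp add: ln_realpow)
  finally have "(\<Sum>i<t. E i) \<le> 2 * ln (real t + 1)" .
  moreover define N where "N = (\<Sum>i<t. (w (Suc i))\<^sup>2) / \<sigma>\<^sup>2"
  have "(\<Sum>i<t. E i) = N / 2 - (\<Sum>i<t. (y (Suc i))\<^sup>2 / var i) / 2 - (\<Sum>i<t. growth i)"
    by (simp add: E_def N_def sum_subtractf sum_divide_distrib mult.commute)
  ultimately show ?thesis using energy_identity[of t] unfolding N_def[symmetric] by linarith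
qed

lemma visits_bound_of_prod:
  assumes "(\<Prod>i<t. visit_weight q K U f (\<theta>, h i, P i, y i) (w (Suc i))) \<le> ennreal ((real t + 1)\<^sup>2)"
  shows "q * card {i. i < t \<and> \<bar>mean i\<bar> \<le> K} - 2 * ln (real t + 1) \<le>
    card {i. i < t \<and> \<bar>mean i\<bar> \<le> K \<and> y (Suc i) \<in> U}"
proof -
  define E where "E i = (if \<bar>mean i\<bar> \<le> K then q else 0) - (if \<bar>mean i\<bar> \<le> K \<and> y (Suc i) \<in> U then 1 else 0)" for i
  have "visit_weight q K U f (\<theta>, h i, P i, y i) (w (Suc i)) = ennreal (exp (E i))" for i
    by (simp add: visit_weight_def E_def mean_def[symmetric] y_Suc indicator_def)
  then have "(\<Prod>i<t. visit_weight q K U f (\<theta>, h i, P i, y i) (w (Suc i))) = ennreal (exp (\<Sum>i<t. E i))"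
    by (simp add: prod_ennreal exp_sum)
  with assms have "exp (\<Sum>i<t. E i) \<le> (real t + 1)\<^sup>2" by (simp add: ennreal_le_iff)
  then have "(\<Sum>i<t. E i) \<le> ln ((real t + 1)\<^sup>2)" by (subst ln_ge_iff) auto
  also have "\<dots> = 2 * ln (real t + 1)" by (simp add: ln_realpow)
  finally have "(\<Sum>i<t. E i) \<le> 2 * ln (real t + 1)" .
  moreover have "(\<Sum>i<t. E i) = q * card {i \<in> {..<t}. \<bar>mean i\<bar> \<le> K} -
      card {i \<in> {..<t}. \<bar>mean i\<bar> \<le> K \<and> y (Suc i) \<in> U}"
    unfolding E_def sum_subtractf
    by (subst (1 2) sum.inter_filter[symmetric]) simp_all
  ultimately show ?thesis by (simp add: lessThan_def)
qed

end

section \<open>Finitely many balls exciting all directions\<close>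

text \<open>By linear independence each unit vector \<open>v\<close> has a point \<open>e\<close>
  with \<open>v \<bullet> f e \<noteq> 0\<close>; continuity extends this to nearby directions and
  points, and compactness of the unit sphere leaves finitely many.\<close>

lemma finite_exciting_balls:
  fixes f :: "real \<Rightarrow> real ^ 'n"
  assumes E: "open E" and cont: "\<And>x. x \<in> E \<Longrightarrow> isCont f x" and indep: "components_lin_indep_on f E"
  shows "\<exists>B \<delta>. finite B \<and> \<delta> > 0 \<and> (\<forall>(a, r)\<in>B. r > 0) \<and>
    (\<forall>v. norm v = 1 \<longrightarrow> (\<exists>(a, r)\<in>B. \<forall>x\<in>ball a r. \<delta> \<le> \<bar>v \<bullet> f x\<bar>))"
proof -
  have "\<exists>e r \<rho> \<delta>. r > 0 \<and> \<rho> > 0 \<and> \<delta> > 0 \<and> (\<forall>v'\<in>ball v \<rho> \<inter> sphere 0 1. \<forall>x\<in>ball e r. \<delta> \<le> \<bar>v' \<bullet> f x\<bar>)"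
    if v: "v \<in> sphere 0 1" for v :: "real ^ 'n"
  proof -
    have "v \<noteq> 0" using v by auto
    then obtain e where e: "e \<in> E" "v \<bullet> f e \<noteq> 0"
      using indep unfolding components_lin_indep_on_def inner_vec_def by auto
    define d where "d = \<bar>v \<bullet> f e\<bar>"
    have d: "d > 0" using e by (simp add: d_def)
    obtain r where r: "r > 0" "\<And>x. x \<in> ball e r \<Longrightarrow> norm (f x - f e) < d / 4"
      using cont[OF e(1)] d unfolding continuous_at_eps_delta
      by (metis dist_norm dist_commute mem_ball zero_less_divide_iff zero_less_numeral)
    \<comment> \<open>Changing the direction and changing the point each cost at most
      \<open>d / 4\<close>, which leaves \<open>d / 2\<close>. The added 1 keeps the denominator
      positive.\<close>
    define \<rho> where "\<rho> = d / (4 * (norm (f e) + 1))"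
    have \<rho>: "\<rho> > 0" using d by (simp add: \<rho>_def add_nonneg_pos)
    have "d / 2 \<le> \<bar>v' \<bullet> f x\<bar>" if v': "v' \<in> ball v \<rho> \<inter> sphere 0 1" and x: "x \<in> ball e r" for v' x
    proof -
      have "\<bar>(v' - v) \<bullet> f e\<bar> \<le> norm (v' - v) * norm (f e)" by (rule Cauchy_Schwarz_ineq2)
      also have "\<dots> \<le> \<rho> * (norm (f e) + 1)"
        using v' \<rho> by (intro mult_mono) (auto simp: dist_norm norm_minus_commute)
      also have "\<dots> = d / 4"
      proof -
        have "norm (f e) + 1 > 0" by (simp add: add_nonneg_pos)
        then show ?thesis by (simp add: \<rho>_def field_simps)
      qed
      finally have 1: "\<bar>(v' - v) \<bullet> f e\<bar> \<le> d / 4" .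
      have "\<bar>v' \<bullet> (f x - f e)\<bar> \<le> norm v' * norm (f x - f e)" by (rule Cauchy_Schwarz_ineq2)
      also have "\<dots> \<le> d / 4" using v' r(2)[OF x] by auto
      finally have 2: "\<bar>v' \<bullet> (f x - f e)\<bar> \<le> d / 4" .
      have "v' \<bullet> f x = v \<bullet> f e + (v' - v) \<bullet> f e + v' \<bullet> (f x - f e)"
        by (simp add: inner_diff_left inner_diff_right)
      then show ?thesis using 1 2 unfolding d_def by linarith
    qed
    then show ?thesis using d r(1) \<rho> by (intro exI[of _ e] exI[of _ r] exI[of _ \<rho>] exI[of _ "d / 2"]) auto
  qed
  then obtain e r \<rho> \<delta> where
    pos: "\<And>v. v \<in> sphere 0 1 \<Longrightarrow> r v > 0 \<and> \<rho> v > 0 \<and> \<delta> v > 0" and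
    exc: "\<And>v v' x. v \<in> sphere 0 1 \<Longrightarrow> v' \<in> ball v (\<rho> v) \<inter> sphere 0 1 \<Longrightarrow> x \<in> ball (e v) (r v) \<Longrightarrow> \<delta> v \<le> \<bar>v' \<bullet> f x\<bar>"
    by metis
  have "sphere 0 1 \<subseteq> (\<Union>v\<in>sphere 0 1. ball v (\<rho> v))" using pos by force
  then obtain T where T: "T \<subseteq> sphere 0 1" "finite T" "sphere 0 1 \<subseteq> (\<Union>v\<in>T. ball v (\<rho> v))"
    using compactE_image[of "sphere (0 :: real ^ 'n) 1" "sphere 0 1" "\<lambda>v. ball v (\<rho> v)"] by auto
  define B where "B = (\<lambda>v. (e v, r v)) ` T"
  define \<delta>' where "\<delta>' = Min (insert 1 (\<delta> ` T))"
  have "\<delta>' > 0" using T pos by (auto simp: \<delta>'_def)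
  moreover have "\<exists>(a, r)\<in>B. \<forall>x\<in>ball a r. \<delta>' \<le> \<bar>v \<bullet> f x\<bar>" if "norm v = 1" for v
  proof -
    have v: "v \<in> sphere 0 1" using that by simp
    then obtain v0 where v0: "v0 \<in> T" "v \<in> ball v0 (\<rho> v0)" using T(3) by blast
    have "\<delta>' \<le> \<bar>v \<bullet> f x\<bar>" if "x \<in> ball (e v0) (r v0)" for x
    proof -
      have "\<delta>' \<le> \<delta> v0" using T(2) v0 by (simp add: \<delta>'_def)
      also have "\<dots> \<le> \<bar>v \<bullet> f x\<bar>" using T(1) v0 v that by (intro exc) auto
      finally show ?thesis .
    qed
    then show ?thesis using v0(1) unfolding B_def by (intro bexI[of _ "(e v0, r v0)"]) auto
  qed
  moreover have "finite B" "\<forall>(a, r)\<in>B. r > 0" using T pos by (auto simp: B_def)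
  ultimately show ?thesis by blast
qed

section \<open>Almost sure bounds for the three product processes\<close>

context ls_stochastic_loop begin

lemma AE_noise_ratio:
  "AE \<omega> in M. \<forall>\<^sub>F t in sequentially. (\<Prod>i<t. noise_ratio \<sigma> (w (Suc i) \<omega>)) \<le> ennreal ((real t + 1)\<^sup>2)"
proof (rule AE_eventually_prod_le[where g = "\<lambda>_. noise_ratio \<sigma>"])
  show "(\<integral>\<^sup>+ v. noise_ratio \<sigma> v \<partial>density lborel (normal_density 0 \<sigma>)) \<le> 1"
    unfolding noise_ratio_def using sigma_pos by (subst nn_integral_normal_density_ratio) auto
qed (unfold noise_ratio_def, measurable)

lemma AE_innovation_ratio:
  "AE \<omega> in M. \<forall>\<^sub>F t in sequentially.
    (\<Prod>i<t. innovation_ratio \<sigma> f (\<theta> \<omega>, h i \<omega>, P i \<omega>, y i \<omega>) (w (Suc i) \<omega>)) \<le> ennreal ((real t + 1)\<^sup>2)"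
proof (rule AE_eventually_prod_le)
  note [measurable] = f_meas
  show "(\<lambda>x. innovation_ratio \<sigma> f (fst x) (snd x)) \<in> borel_measurable (borel \<Otimes>\<^sub>M borel)"
    unfolding innovation_ratio_def case_prod_beta normal_density_def borel_prod[symmetric] by measurable
  show "(\<integral>\<^sup>+ v. innovation_ratio \<sigma> f s v \<partial>density lborel (normal_density 0 \<sigma>)) \<le> 1" for s
    unfolding innovation_ratio_def case_prod_beta using sigma_pos
    by (subst nn_integral_normal_density_ratio) (auto simp: less_max_iff_disj)
qed

text \<open>The hitting probability of the ball is bounded below uniformly over means of modulus at
  most \<open>K\<close>, so one \<open>q\<close> serves all states.\<close>

lemma AE_visit_weight:
  assumes "r > 0"
  shows "\<exists>q>0. AE \<omega> in M. \<forall>\<^sub>F t in sequentially.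
    (\<Prod>i<t. visit_weight q K (ball a r) f (\<theta> \<omega>, h i \<omega>, P i \<omega>, y i \<omega>) (w (Suc i) \<omega>)) \<le> ennreal ((real t + 1)\<^sup>2)"
proof -
  define p where "p = 2 * r * normal_density 0 \<sigma> (\<bar>a\<bar> + r + K)"
  define q where "q = (1 - exp (-1)) * p"
  have "p > 0" using assms normal_density_pos[OF sigma_pos] by (simp add: p_def)
  then have "q > 0" by (simp add: q_def)
  moreover have "AE \<omega> in M. \<forall>\<^sub>F t in sequentially.
    (\<Prod>i<t. visit_weight q K (ball a r) f (\<theta> \<omega>, h i \<omega>, P i \<omega>, y i \<omega>) (w (Suc i) \<omega>)) \<le> ennreal ((real t + 1)\<^sup>2)"
  proof (rule AE_eventually_prod_le)
    note [measurable] = f_meas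
    show "(\<lambda>x. visit_weight q K (ball a r) f (fst x) (snd x)) \<in> borel_measurable (borel \<Otimes>\<^sub>M borel)"
      unfolding visit_weight_def case_prod_beta borel_prod[symmetric] indicator_def mem_Collect_eq
        mem_ball dist_real_def by measurable
    fix s :: "(real ^ 'n) \<times> (real ^ 'n) \<times> (real ^ 'n ^ 'n) \<times> real"
    define m where "m = (fst s - fst (snd s)) \<bullet> f (snd (snd (snd s)))"
    interpret N: prob_space "density lborel (normal_density 0 \<sigma>)"
      by (rule prob_space_normal_density[OF sigma_pos])
    have "{v. m + v \<in> ball a r} \<in> sets borel" unfolding mem_ball dist_real_def by measurable
    then show "(\<integral>\<^sup>+ v. visit_weight q K (ball a r) f s v \<partial>density lborel (normal_density 0 \<sigma>)) \<le> 1"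
      using nn_integral_visit_weight_le_1[OF sigma_pos _ normal_ball_lower_bound[OF sigma_pos assms] q_def[unfolded p_def]]
        N.emeasure_space_1
      unfolding visit_weight_def case_prod_beta m_def[symmetric] by (cases "\<bar>m\<bar> \<le> K") auto
  qed
  ultimately show ?thesis by blast
qed

end

section \<open>Strong consistency with rate\<close>

theorem theorem3p1:
  fixes M :: "'a measure"
    and \<theta> :: "'a \<Rightarrow> real ^ 'n" and \<theta>0 :: "real ^ 'n"
    and w :: "nat \<Rightarrow> 'a \<Rightarrow> real" and \<sigma> :: real
    and f :: "real \<Rightarrow> real ^ 'n" and E :: "real set"
    and idx :: "nat \<Rightarrow> 'n" and b :: "nat \<Rightarrow> real" and L1 L2 :: real
    and y0 :: real and y u :: "nat \<Rightarrow> 'a \<Rightarrow> real"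
    and \<theta>hat :: "nat \<Rightarrow> 'a \<Rightarrow> real ^ 'n" and P :: "nat \<Rightarrow> 'a \<Rightarrow> real ^ 'n ^ 'n"
  assumes prob: "prob_space M"
    and n_ge_2: "CARD('n) \<ge> 2"
    and idx: "bij_betw idx {1..CARD('n)} UNIV"
    and f_meas: "f \<in> borel_measurable borel"
    and E_open: "open E"
    and f_Cn: "\<And>j. j \<in> {1..CARD('n)} \<Longrightarrow> Ck_on CARD('n) (\<lambda>x. f x $ idx j) E"
    and sigma_pos: "\<sigma> > 0"
    and A1_indep: "prob_space.indep_vars M (\<lambda>_. borel) w {1..}"
    and A1_ident: "\<And>t. t \<ge> 1 \<Longrightarrow> distr M borel (w t) = distr M borel (w 1)"
    and A1_normal: "distributed M lborel (w 1) (normal_density 0 \<sigma>)"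
    and A2_normal: "distributed M lborel \<theta> (mv_normal_density \<theta>0 (mat 1))"
    and A2_indep: "indep_rvs M borel \<theta> (PiM {1..} (\<lambda>_. borel)) (\<lambda>\<omega>. \<lambda>t\<in>{1..}. w t \<omega>)"
    and A3: "components_lin_indep_on f E"
    and closed_loop: "\<And>\<omega>. \<omega> \<in> space M \<Longrightarrow>
      ls_closed_loop \<sigma> \<theta>0 f y0 (\<theta> \<omega>) (\<lambda>t. w t \<omega>)
        (\<lambda>t. y t \<omega>) (\<lambda>t. u t \<omega>) (\<lambda>t. \<theta>hat t \<omega>) (\<lambda>t. P t \<omega>)"
    and b_decreasing: "\<And>i. i \<in> {1..<CARD('n)} \<Longrightarrow> b i > b (i + 1)"
    and b_pos: "b CARD('n) > 0"
    and b1_gt_1: "b 1 > 1"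
    and P_pos: "\<And>x. 1 < x \<Longrightarrow> x < b 1 \<Longrightarrow>
      x ^ (CARD('n) + 1) - b 1 * x ^ CARD('n)
        + (\<Sum>i = 1..CARD('n) - 1. (b i - b (i + 1)) * x ^ (CARD('n) - i)) + b CARD('n) > 0"
    and L_pos: "L1 > 0" "L2 > 0"
    and growth: "\<And>x j. j \<in> {1..CARD('n)} \<Longrightarrow> \<bar>f x $ idx j\<bar> \<le> L1 + L2 * \<bar>x\<bar> powr b j"
  shows "(AE \<omega> in M. (\<lambda>t. \<theta>hat t \<omega>) \<longlonglongrightarrow> \<theta> \<omega>) \<and>
    (AE \<omega> in M. (\<lambda>t. (norm (\<theta>hat (t + 1) \<omega> - \<theta> \<omega>))\<^sup>2) \<in> O(\<lambda>t. ln (real t) / real t))"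
proof -
  have "distr M borel (w 1) = distr M lborel (w 1)" by (rule distr_cong) auto
  also have "\<dots> = density lborel (normal_density 0 \<sigma>)"
    using A1_normal by (rule distributed_distr_eq_density)
  finally have law: "distr M borel (w t) = density lborel (normal_density 0 \<sigma>)" if "t \<ge> 1" for t
    using A1_ident[OF that] by (rule trans[rotated])
  interpret prob_space M by fact
  interpret ls_stochastic_loop M \<sigma> \<theta>0 f y0 \<theta> w y u \<theta>hat P
    by unfold_locales (fact sigma_pos f_meas A1_indep law A2_indep closed_loop)+
  have cont: "isCont f x" if "x \<in> E" for x
    unfolding isCont_def
  proof (rule vec_tendstoI)
    fix i :: 'n
    obtain j where j: "j \<in> {1..CARD('n)}" "i = idx j"
      using idx unfolding bij_betw_def by (metis UNIV_I imageE)
    have "(deriv ^^ 0) (\<lambda>x. f x $ i) field_differentiable at x"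
      using f_Cn[OF j(1)] that n_ge_2 unfolding Ck_on_def j(2) by (metis not_numeral_le_zero gr0I)
    then have "isCont (\<lambda>x. f x $ i) x" using field_differentiable_imp_continuous_at by auto
    then show "(\<lambda>x. f x $ i) \<midarrow>x\<rightarrow> f x $ i" by (simp add: isCont_def)
  qed
  obtain B \<delta> where B: "finite B" "\<delta> > 0" "\<And>a r. (a, r) \<in> B \<Longrightarrow> r > 0"
    and excite: "\<And>v. norm v = 1 \<Longrightarrow> \<exists>(a, r)\<in>B. \<forall>x\<in>ball a r. \<delta> \<le> \<bar>v \<bullet> f x\<bar>"
    using finite_exciting_balls[OF E_open cont A3] by blast
  define visited where "visited a r K q \<omega> \<longleftrightarrow> (\<forall>\<^sub>F t in sequentially.
    (\<Prod>i<t. visit_weight q (real K) (ball a r) f (\<theta> \<omega>, \<theta>hat i \<omega>, P i \<omega>, y i \<omega>) (w (Suc i) \<omega>)) \<le>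
      ennreal ((real t + 1)\<^sup>2))" for a r K q \<omega>
  have "\<exists>q>0. AE \<omega> in M. visited a r K q \<omega>" if "(a, r) \<in> B" for a r and K :: nat
    unfolding visited_def by (rule AE_visit_weight[OF B(3)[OF that]])
  then obtain q where q: "\<And>a r K. (a, r) \<in> B \<Longrightarrow> q a r K > 0"
    and q_AE: "\<And>a r K. (a, r) \<in> B \<Longrightarrow> AE \<omega> in M. visited a r K (q a r K) \<omega>"
    by metis
  \<comment> \<open>The bound \<open>K\<close> on the means depends on the sample path, so a single
    null set must serve all \<open>K\<close>; as \<open>K\<close> is a natural number and
    \<open>B\<close> is finite, the union of null sets is countable.\<close>
  have visits: "AE \<omega> in M. \<forall>(a, r)\<in>B. \<forall>K. visited a r K (q a r K) \<omega>"
    using q_AE B(1) by (auto simp: AE_finite_all AE_all_countable)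
  have rate: "AE \<omega> in M. (\<lambda>t. (norm (\<theta>hat (t + 1) \<omega> - \<theta> \<omega>))\<^sup>2) \<in> O(\<lambda>t. ln (real t) / real t)"
    using AE_noise_ratio AE_innovation_ratio visits AE_space
  proof eventually_elim
    case (elim \<omega>)
    interpret L: ls_loop \<sigma> \<theta>0 f y0 "\<theta> \<omega>" "\<lambda>t. w t \<omega>" "\<lambda>t. y t \<omega>" "\<lambda>t. u t \<omega>" "\<lambda>t. \<theta>hat t \<omega>" "\<lambda>t. P t \<omega>"
      by unfold_locales (fact sigma_pos closed_loop[OF elim(4)])+
    obtain C where C: "\<And>t. (\<Sum>i<t. (w (Suc i) \<omega>)\<^sup>2) \<le> C * (real t + 1)"
      using L.noise_bound_of_prod[OF elim(1)] by blast
    obtain C' where C': "\<And>t. (\<Sum>i<t. L.growth i) \<le> C' * ln (real t + 2)"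
      using L.sum_growth_log[OF idx L_pos growth b_decreasing b_pos b1_gt_1 P_pos C] by blast
    show ?case
    proof (rule L.consistency_pathwise[OF C C' _ _ _ B(2)])
      show "\<forall>\<^sub>F t in sequentially. L.energy t \<le> (norm (\<theta> \<omega> - \<theta>0))\<^sup>2 + 2 * (\<Sum>i<t. L.growth i) + 4 * ln (real t + 1)"
        using elim(2) by (rule eventually_mono) (rule L.energy_bound_of_prod)
      show "finite ((\<lambda>(a, r). ball a r) ` B)" using B(1) by simp
      show "\<exists>U\<in>(\<lambda>(a, r). ball a r) ` B. \<forall>x\<in>U. \<delta> \<le> \<bar>v \<bullet> f x\<bar>" if "norm v = 1" for v
        using excite[OF that] by auto
      fix U K assume "U \<in> (\<lambda>(a, r). ball a r) ` B"
      then obtain a r where ar: "(a, r) \<in> B" "U = ball a r" by auto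
      have "\<forall>\<^sub>F t in sequentially. q a r K * card {i. i < t \<and> \<bar>L.mean i\<bar> \<le> real K} - 2 * ln (real t + 1) \<le>
        card {i. i < t \<and> \<bar>L.mean i\<bar> \<le> real K \<and> y (Suc i) \<omega> \<in> U}"
      proof -
        have "visited a r K (q a r K) \<omega>" using elim(3) ar(1) by auto
        then show ?thesis unfolding visited_def ar(2)
          by (rule eventually_mono) (rule L.visits_bound_of_prod)
      qed
      then show "\<exists>q>(0::real). \<forall>\<^sub>F t in sequentially.
        q * card {i. i < t \<and> \<bar>L.mean i\<bar> \<le> real K} - 2 * ln (real t + 1) \<le>
        card {i. i < t \<and> \<bar>L.mean i\<bar> \<le> real K \<and> y (Suc i) \<omega> \<in> U}"
        using q[OF ar(1)] by blast
    qed
  qed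
  moreover have "AE \<omega> in M. (\<lambda>t. \<theta>hat t \<omega>) \<longlonglongrightarrow> \<theta> \<omega>"
    using rate
  proof eventually_elim
    case (elim \<omega>)
    \<comment> \<open>Plain convergence follows because the rate tends to 0; the index shift is
      undone at the end.\<close>
    have "(\<lambda>t::nat. ln (real t) / real t) \<in> o(\<lambda>_. 1)" by real_asymp
    with elim have "(\<lambda>t. (norm (\<theta>hat (t + 1) \<omega> - \<theta> \<omega>))\<^sup>2) \<in> o(\<lambda>_. 1)"
      by (rule landau_o.big_small_trans)
    then have "(\<lambda>t. (norm (\<theta>hat (t + 1) \<omega> - \<theta> \<omega>))\<^sup>2) \<longlonglongrightarrow> 0"
      using smalloD_tendsto by fastforce
    then have "(\<lambda>t. sqrt ((norm (\<theta>hat (t + 1) \<omega> - \<theta> \<omega>))\<^sup>2)) \<longlonglongrightarrow> sqrt 0"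
      by (rule tendsto_real_sqrt)
    then have "(\<lambda>t. \<theta>hat (Suc t) \<omega> - \<theta> \<omega>) \<longlonglongrightarrow> 0"
      by (simp add: tendsto_norm_zero_iff)
    then show ?case by (simp add: LIM_zero_iff filterlim_sequentially_Suc[of "\<lambda>t. \<theta>hat t \<omega>"])
  qed
  ultimately show ?thesis by blast
qed

end
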